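(* Let $N=2^n$ and let $N'>N$ be an integer. Let $H$ be a Hermitian operator on $\mathbb{C}^N$ (the Hamiltonian), with spectral norm $\|H\|$. Let $|\psi_0\rangle_{AB}\in\mathbb{C}^N\otimes\mathbb{C}^{N'}$ be a fixed unit vector, let $U$ be a Haar-random element of the unitary group $\mathsf{U}(NN')$, and let $\rho(U)=\mathrm{Tr}_B\big[U|\psi_0\rangle\langle\psi_0|_{AB}U^\dagger\big]$ be the resulting (almost surely full-rank) random density matrix on $\mathbb{C}^N$. Then for every $\gamma>2\|H\|\sqrt{N/N'}$, $$\Pr\big[\mathrm{Erg}(\rho(U))>\gamma\big]\le \exp\left[-\frac{NN'\gamma^2}{768\,\|H\|^2}\right].$$
   Context: $\mathsf{U}(k)$ is the group of $k\times k$ unitary matrices; "Haar-random" refers to its normalized Haar measure. $A$ is the first ($N$-dimensional) tensor factor, $B$ the second ($N'$-dimensional) one, and $\mathrm{Tr}_B$ is the partial trace over $B$. For a density matrix $\rho$ on $\mathbb{C}^N$ (positive semidefinite, trace one), the ergotropy with respect to $H$ is $$\mathrm{Erg}(\rho)=\max_{V\in\mathsf{U}(N)}\mathrm{Tr}\big[H(\rho-V\rho V^\dagger)\big].$$ *)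

theory Defs
  imports "HOL-Probability.Probability"
begin

definition adjoint_matrix :: "complex^'m^'n \<Rightarrow> complex^'n^'m" where
  "adjoint_matrix A = (\<chi> i j. cnj (A $ j $ i))"

definition hermitian :: "complex^'n^'n \<Rightarrow> bool" where
  "hermitian A \<longleftrightarrow> adjoint_matrix A = A"

definition unitary_group :: "(complex^'n^'n) set" where
  "unitary_group = {U. adjoint_matrix U ** U = mat 1 \<and> U ** adjoint_matrix U = mat 1}"

text \<open>
  The norm on \<^typ>\<open>complex^'n\<close> is the Hermitian \<open>l\<^sup>2\<close> norm, so this is the largest singular value.
\<close>

definition spectral_norm :: "complex^'n^'n \<Rightarrow> real" where
  "spectral_norm A = onorm (\<lambda>v. A *v v)"

definition rank_one_projector :: "complex^'n \<Rightarrow> complex^'n^'n" where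
  "rank_one_projector \<psi> = (\<chi> i j. \<psi> $ i * cnj (\<psi> $ j))"

definition partial_trace_B :: "complex^('a::finite \<times> 'b::finite)^('a \<times> 'b) \<Rightarrow> complex^'a^'a" where
  "partial_trace_B X = (\<chi> i j. \<Sum>k\<in>UNIV. X $ (i, k) $ (j, k))"

definition reduced_state ::
  "complex^('a::finite \<times> 'b::finite) \<Rightarrow> complex^('a \<times> 'b)^('a \<times> 'b) \<Rightarrow> complex^'a^'a" where
  "reduced_state \<psi> U = partial_trace_B (U ** rank_one_projector \<psi> ** adjoint_matrix U)"

definition density_matrix :: "complex^'n^'n \<Rightarrow> bool" where
  "density_matrix \<rho> \<longleftrightarrow>
     hermitian \<rho> \<and> (\<forall>v. 0 \<le> Re (\<Sum>i\<in>UNIV. cnj (v $ i) * (\<rho> *v v) $ i)) \<and> trace \<rho> = 1"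

text \<open>
  For Hermitian \<open>H\<close> and \<open>\<rho>\<close> the trace below is real. The supremum is a maximum, because the
  unitary group is compact; see \<open>ergotropy_attained\<close>.
\<close>

definition ergotropy :: "complex^'n^'n \<Rightarrow> complex^'n^'n \<Rightarrow> real" where
  "ergotropy H \<rho> =
     (SUP V\<in>unitary_group. Re (trace (H ** (\<rho> - V ** \<rho> ** adjoint_matrix V))))"

text \<open>
  The normalized Haar measure is the unique left-invariant Borel probability measure on the unitary
  group; since the group is compact, right invariance and regularity are automatic.
\<close>

definition haar_unitary :: "(complex^'n^'n) measure \<Rightarrow> bool" where
  "haar_unitary M \<longleftrightarrow>
     prob_space M \<and> sets M = sets (restrict_space borel unitary_group) \<and>
     (\<forall>V\<in>unitary_group. \<forall>A\<in>sets M. emeasure M ((\<lambda>U. V ** U) ` A) = emeasure M A)"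

lemma adjoint_matrix_nth [simp]: "adjoint_matrix A $ i $ j = cnj (A $ j $ i)"
  by (simp add: adjoint_matrix_def)

lemma adjoint_matrix_mult: "adjoint_matrix (A ** B) = adjoint_matrix B ** adjoint_matrix A"
  by (simp add: vec_eq_iff matrix_matrix_mult_def mult.commute)

lemma adjoint_matrix_adjoint_matrix [simp]: "adjoint_matrix (adjoint_matrix A) = A"
  by (simp add: vec_eq_iff)

lemma continuous_on_matrix_mult:
  fixes f :: "'t::topological_space \<Rightarrow> complex^'m^'n" and g :: "'t \<Rightarrow> complex^'k^'m"
  assumes "continuous_on S f" "continuous_on S g"
  shows "continuous_on S (\<lambda>x. f x ** g x)"
  unfolding matrix_matrix_mult_def by (intro continuous_intros assms)

lemma continuous_on_adjoint_matrix:
  fixes f :: "'t::topological_space \<Rightarrow> complex^'m^'n"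
  assumes "continuous_on S f"
  shows "continuous_on S (\<lambda>x. adjoint_matrix (f x))"
  unfolding adjoint_matrix_def by (intro continuous_intros assms)

lemma continuous_on_trace:
  fixes f :: "'t::topological_space \<Rightarrow> complex^'n^'n"
  assumes "continuous_on S f"
  shows "continuous_on S (\<lambda>x. trace (f x))"
  unfolding trace_def by (intro continuous_intros assms)

lemma unitary_group_entry_le_1:
  fixes U :: "complex^'n^'n"
  assumes "U \<in> unitary_group"
  shows "norm (U $ i $ j) \<le> 1"
proof -
  have "(adjoint_matrix U ** U) $ j $ j = 1"
    using assms by (simp add: unitary_group_def mat_def)
  then have "(\<Sum>k\<in>UNIV. cnj (U $ k $ j) * U $ k $ j) = 1"
    by (simp add: matrix_matrix_mult_def)
  then have "complex_of_real (\<Sum>k\<in>UNIV. (norm (U $ k $ j))\<^sup>2) = 1"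
    by (simp add: complex_norm_square mult.commute del: of_real_power)
  then have "(\<Sum>k\<in>UNIV. (norm (U $ k $ j))\<^sup>2) = 1"
    using of_real_eq_1_iff by blast
  moreover have "(norm (U $ i $ j))\<^sup>2 \<le> (\<Sum>k\<in>UNIV. (norm (U $ k $ j))\<^sup>2)"
    by (intro member_le_sum) auto
  ultimately show ?thesis
    using abs_square_le_1[of "norm (U $ i $ j)"] by simp
qed

lemma compact_unitary_group: "compact (unitary_group :: (complex^'n^'n) set)"
proof -
  have "norm U \<le> (\<Sum>i\<in>(UNIV::'n set). \<Sum>j\<in>(UNIV::'n set). 1)" if "U \<in> unitary_group" for U :: "complex^'n^'n"
  proof -
    have "norm U \<le> (\<Sum>i\<in>UNIV. norm (U $ i))"
      by (simp add: norm_vec_def L2_set_le_sum)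
    also have "\<dots> \<le> (\<Sum>i\<in>UNIV. \<Sum>j\<in>UNIV. norm (U $ i $ j))"
      by (intro sum_mono) (simp add: norm_vec_def L2_set_le_sum)
    also have "\<dots> \<le> (\<Sum>i\<in>(UNIV::'n set). \<Sum>j\<in>(UNIV::'n set). 1)"
      by (intro sum_mono unitary_group_entry_le_1 that)
    finally show ?thesis .
  qed
  then have "bounded (unitary_group :: (complex^'n^'n) set)"
    unfolding bounded_iff by blast
  moreover have "closed (unitary_group :: (complex^'n^'n) set)"
    unfolding unitary_group_def
    by (intro closed_Collect_conj closed_Collect_eq continuous_on_matrix_mult
        continuous_on_adjoint_matrix continuous_on_id continuous_on_const)
  ultimately show ?thesis
    by (simp add: compact_eq_bounded_closed)
qed

lemma mat_1_in_unitary_group: "mat 1 \<in> unitary_group"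
proof -
  have "adjoint_matrix (mat 1 :: complex^'n^'n) = mat 1"
    by (simp add: vec_eq_iff mat_def)
  then show ?thesis
    by (simp add: unitary_group_def)
qed

lemma continuous_on_extracted_work:
  "continuous_on S (\<lambda>V. Re (trace (H ** (\<rho> - V ** \<rho> ** adjoint_matrix V))))"
  by (intro continuous_intros continuous_on_trace continuous_on_matrix_mult
      continuous_on_adjoint_matrix)

lemma ergotropy_attained:
  fixes H \<rho> :: "complex^'n^'n"
  obtains V where "V \<in> unitary_group"
    and "ergotropy H \<rho> = Re (trace (H ** (\<rho> - V ** \<rho> ** adjoint_matrix V)))"
    and "\<And>W. W \<in> unitary_group \<Longrightarrow>
      Re (trace (H ** (\<rho> - W ** \<rho> ** adjoint_matrix W))) \<le> ergotropy H \<rho>"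
proof -
  let ?f = "\<lambda>V. Re (trace (H ** (\<rho> - V ** \<rho> ** adjoint_matrix V)))"
  have "\<exists>V\<in>unitary_group. \<forall>W\<in>unitary_group. ?f W \<le> ?f V"
    using mat_1_in_unitary_group
    by (intro continuous_attains_sup compact_unitary_group continuous_on_extracted_work) auto
  then obtain V where V: "V \<in> unitary_group" "\<And>W. W \<in> unitary_group \<Longrightarrow> ?f W \<le> ?f V"
    by blast
  have "ergotropy H \<rho> = ?f V"
    unfolding ergotropy_def by (rule cSup_eq_maximum) (use V in auto)
  then show thesis
    using that V by simp
qed

lemma haar_unitary_space: "haar_unitary M \<Longrightarrow> space M = unitary_group"
  unfolding haar_unitary_def by (auto dest: sets_eq_imp_space_eq simp: space_restrict_space)

lemma continuous_on_reduced_state: "continuous_on S (reduced_state \<psi>)"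
  unfolding reduced_state_def partial_trace_B_def
  by (intro continuous_intros continuous_on_matrix_mult continuous_on_adjoint_matrix)

lemma ergotropy_event_measurable:
  fixes H :: "complex^'a^'a" and \<psi> :: "complex^('a::finite \<times> 'b::finite)"
  assumes "haar_unitary M"
  shows "{U \<in> space M. ergotropy H (reduced_state \<psi> U) > \<gamma>} \<in> sets M"
proof -
  let ?g = "\<lambda>V U. Re (trace (H ** (reduced_state \<psi> U - V ** reduced_state \<psi> U ** adjoint_matrix V)))"
  have "ergotropy H (reduced_state \<psi> U) > \<gamma> \<longleftrightarrow> (\<exists>V\<in>unitary_group. ?g V U > \<gamma>)" for U
    by (rule ergotropy_attained[of H "reduced_state \<psi> U"]) force
  then have eq: "{U \<in> space M. ergotropy H (reduced_state \<psi> U) > \<gamma>} =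
      unitary_group \<inter> (\<Union>V\<in>unitary_group. {U. ?g V U > \<gamma>})"
    using haar_unitary_space[OF assms] by auto
  have "open (\<Union>V\<in>unitary_group. {U. ?g V U > \<gamma>})"
    by (intro open_UN ballI open_Collect_less continuous_intros continuous_on_trace
        continuous_on_matrix_mult continuous_on_reduced_state)
  then have "(\<Union>V\<in>unitary_group. {U. ?g V U > \<gamma>}) \<in> sets borel"
    by (rule borel_open)
  then show ?thesis
    using assms unfolding eq haar_unitary_def by (auto simp: sets_restrict_space)
qed

lemma trace_partial_trace_B: "trace (partial_trace_B X) = trace X"
  unfolding trace_def partial_trace_B_def vec_lambda_beta sum.cartesian_product UNIV_Times_UNIV
  by (rule sum.cong) auto

lemma unitary_conj_rank_one_projector:
  "U ** rank_one_projector \<psi> ** adjoint_matrix U = rank_one_projector (U *v \<psi>)"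
proof -
  have "(\<Sum>l\<in>UNIV. (\<Sum>k\<in>UNIV. U $ i $ k * (\<psi> $ k * cnj (\<psi> $ l))) * cnj (U $ j $ l))
      = (\<Sum>k\<in>UNIV. U $ i $ k * \<psi> $ k) * (\<Sum>l\<in>UNIV. cnj (U $ j $ l) * cnj (\<psi> $ l))" for i j
    by (simp add: sum_distrib_left sum_distrib_right mult_ac)
  then show ?thesis
    by (simp add: vec_eq_iff matrix_matrix_mult_def matrix_vector_mult_def rank_one_projector_def)
qed

lemma trace_rank_one_projector: "trace (rank_one_projector \<psi>) = complex_of_real ((norm \<psi>)\<^sup>2)"
  by (simp add: trace_def rank_one_projector_def norm_vec_def L2_set_def sum_nonneg
      complex_norm_square del: of_real_power)

lemma density_matrix_reduced_state:
  fixes \<psi> :: "complex^('a::finite \<times> 'b::finite)"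
  assumes "norm \<psi> = 1" and "U \<in> unitary_group"
  shows "density_matrix (reduced_state \<psi> U)"
  unfolding density_matrix_def
proof (intro conjI allI)
  define \<phi> where "\<phi> = U *v \<psi>"
  have nth: "reduced_state \<psi> U $ i $ j = (\<Sum>k\<in>UNIV. \<phi> $ (i, k) * cnj (\<phi> $ (j, k)))" for i j
    unfolding reduced_state_def unitary_conj_rank_one_projector \<phi>_def
    by (simp add: partial_trace_B_def rank_one_projector_def)
  show "hermitian (reduced_state \<psi> U)"
    by (simp add: hermitian_def vec_eq_iff nth mult.commute)
  have "trace (reduced_state \<psi> U) = trace (adjoint_matrix U ** (U ** rank_one_projector \<psi>))"
    unfolding reduced_state_def trace_partial_trace_B by (rule trace_mul_sym)
  also have "\<dots> = trace (rank_one_projector \<psi>)"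
    using assms(2) by (simp add: matrix_mul_assoc unitary_group_def)
  finally show "trace (reduced_state \<psi> U) = 1"
    using assms(1) by (simp add: trace_rank_one_projector)
  show "0 \<le> Re (\<Sum>i\<in>UNIV. cnj (v $ i) * (reduced_state \<psi> U *v v) $ i)" for v
  proof -
    let ?c = "\<lambda>k. \<Sum>i\<in>UNIV. cnj (v $ i) * \<phi> $ (i, k)"
    have "(\<Sum>i\<in>UNIV. cnj (v $ i) * (reduced_state \<psi> U *v v) $ i)
        = (\<Sum>i\<in>UNIV. \<Sum>j\<in>UNIV. \<Sum>k\<in>UNIV. cnj (v $ i) * \<phi> $ (i, k) * (v $ j * cnj (\<phi> $ (j, k))))"
      by (simp add: matrix_vector_mult_def nth sum_distrib_left sum_distrib_right mult_ac)
    also have "\<dots> = (\<Sum>i\<in>UNIV. \<Sum>k\<in>UNIV. \<Sum>j\<in>UNIV. cnj (v $ i) * \<phi> $ (i, k) * (v $ j * cnj (\<phi> $ (j, k))))"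
      by (intro sum.cong refl sum.swap)
    also have "\<dots> = (\<Sum>k\<in>UNIV. \<Sum>i\<in>UNIV. \<Sum>j\<in>UNIV. cnj (v $ i) * \<phi> $ (i, k) * (v $ j * cnj (\<phi> $ (j, k))))"
      by (rule sum.swap)
    also have "\<dots> = (\<Sum>k\<in>UNIV. ?c k * cnj (?c k))"
      by (simp add: sum_product)
    also have "\<dots> = complex_of_real (\<Sum>k\<in>UNIV. (norm (?c k))\<^sup>2)"
      by (simp only: complex_norm_square of_real_sum)
    finally show ?thesis
      by (simp add: sum_nonneg del: of_real_sum of_real_power)
  qed
qed

end

(*
  Proof idea.  By unitary invariance, U psi is the direction of a standard complex Gaussian vector g.
  Writing erg(x) for the ergotropy of the reduced state of x, erg is a pointwise maximum of quadratic
  forms x \<bullet> A x with norm A \<le> 2 * spectral_norm H.  The Maurey--Pisier argument (rotate a Gaussian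
  vector into an independent copy in many small steps, and use convexity of exp) bounds
  E exp (s (erg g - erg g')).  Since erg is homogeneous of degree 2, integrating out the radius carries this
  over to the sphere with s replaced by 2 N N' s, where Jensen's inequality centers it at the
  mean.  The mean is at most spectral_norm H * sqrt (N / N') < \<gamma> / 2, because the work extracted exceeds
  Tr (H \<rho>) - Tr H / N, a centered variable, by at most spectral_norm H * sqrt N times the
  Hilbert--Schmidt distance of \<rho> to the maximally mixed state, whose second moment is explicit.
  Markov's inequality with s = \<gamma> / (320 (spectral_norm H)^2) gives the rate 1/640 in place of 1/768.
*)
theory Submission
  imports Defs
begin

section \<open>Gaussian measures on Euclidean spaces\<close>

text \<open>Two features shape the route. A maximum of quadratic forms has no gradient to insert
  into the usual interpolation, so finite rotations are used: the form that is optimal at one point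
  bounds the value at the next point from below, and each increment is dominated by a quadratic
  expression whose Gaussian integral is exact. And quadratic growth lets E exp (s erg g) converge
  only for small s. This costs nothing: erg is at most \<open>2 * spectral_norm H\<close> on the
  sphere, so only \<gamma> \<le> \<open>2 * spectral_norm H\<close> matters, and there the optimal s
  is small enough.

  Concentration is kept as the product E exp (s erg g) E exp (- s erg g), because each factor moves
  to the sphere separately and the Gaussian mean never has to be compared with the spherical one.

  Centering matters for the mean: with K conjugate to H, estimating all of Tr ((H - K) (\<rho> -
  1/N)) by Hilbert-Schmidt norms would give \<open>2 * spectral_norm H\<close> times sqrt (N / N'),
  which leaves no definite gap below \<gamma>. Half of that leaves \<gamma> / 2 for the
  deviation.\<close>

lemma distr_lborel_isometry:
  fixes T :: "'e::euclidean_space \<Rightarrow> 'e"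
  assumes lin: "linear T" and iso: "\<And>x. norm (T x) = norm x"
  shows "distr lborel borel T = lborel"
proof (rule measure_eqI)
  interpret linear T by (rule lin)
  have meas [measurable]: "T \<in> borel_measurable borel"
    by (intro borel_measurable_continuous_onI linear_continuous_on linear_conv_bounded_linear[THEN iffD1] lin)
  have "inj T"
    by (rule injI) (metis diff iso norm_eq_zero right_minus_eq)
  then have "surj T"
    using lin by (simp add: linear_injective_imp_surjective)
  have shift: "(\<integral>\<^sup>+x. g (T x - y) \<partial>lborel) = (\<integral>\<^sup>+x. g (T x) \<partial>lborel)"
    if [measurable]: "g \<in> borel_measurable borel" for g :: "'e \<Rightarrow> ennreal" and y
  proof -
    obtain t where t: "y = T t"
      using \<open>surj T\<close> by (meson surj_def)
    have "(\<integral>\<^sup>+x. g (T x) \<partial>lborel) = (\<integral>\<^sup>+x. g (T x) \<partial>distr lborel borel ((+) (- t)))"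
      by (simp add: lborel_distr_plus)
    also have "\<dots> = (\<integral>\<^sup>+x. g (T x - y) \<partial>lborel)"
      by (subst nn_integral_distr) (simp_all add: t diff)
    finally show ?thesis by simp
  qed
  have plus: "(\<integral>\<^sup>+y. g (y + z) \<partial>lborel) = (\<integral>\<^sup>+y. g y \<partial>lborel)"
    if [measurable]: "g \<in> borel_measurable borel" for g :: "'e \<Rightarrow> ennreal" and z
    by (subst (2) lborel_distr_plus[symmetric, of z], subst nn_integral_distr) (simp_all add: add.commute)
  have refl: "(\<integral>\<^sup>+y. g (z - y) \<partial>lborel) = (\<integral>\<^sup>+y. g y \<partial>lborel)"
    if [measurable]: "g \<in> borel_measurable borel" for g :: "'e \<Rightarrow> ennreal" and z
    by (subst (2) lborel_affine[of "-1" z]) (simp_all add: nn_integral_density nn_integral_distr)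
  fix A assume "A \<in> sets (distr lborel borel T)"
  then have [measurable]: "A \<in> sets borel" by simp
  \<comment> \<open>What follows is the uniqueness argument for translation-invariant measures:
    Fubini compares the image measure with \<open>lborel\<close> through a test function of finite
    nonzero integral. The indicator of the unit ball is fixed by every isometry, which forces the
    proportionality constant to be 1 and takes the place of a determinant.\<close>
  define g :: "'e \<Rightarrow> ennreal" where "g = indicator (ball 0 1)"
  have [measurable]: "g \<in> borel_measurable borel"
    unfolding g_def by (intro borel_measurable_indicator borel_open open_ball)
  have gT: "g (T x) = g x" for x
    by (simp add: g_def indicator_def iso)
  have "emeasure (distr lborel borel T) A * integral\<^sup>N lborel g
      = (\<integral>\<^sup>+x. indicator A (T x) * integral\<^sup>N lborel g \<partial>lborel)"
    by (simp add: nn_integral_multc nn_integral_distr flip: nn_integral_indicator)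
  also have "\<dots> = (\<integral>\<^sup>+x. (\<integral>\<^sup>+y. indicator A (T x) * g (y + T x) \<partial>lborel) \<partial>lborel)"
    by (simp add: nn_integral_cmult plus)
  also have "\<dots> = (\<integral>\<^sup>+y. (\<integral>\<^sup>+x. indicator A (T x) * g (y + T x) \<partial>lborel) \<partial>lborel)"
    by (rule lborel_pair.Fubini') measurable
  also have "\<dots> = (\<integral>\<^sup>+y. (\<integral>\<^sup>+x. indicator A (T x - y) * g (T x) \<partial>lborel) \<partial>lborel)"
  proof (rule nn_integral_cong)
    fix y
    show "(\<integral>\<^sup>+x. indicator A (T x) * g (y + T x) \<partial>lborel) =
          (\<integral>\<^sup>+x. indicator A (T x - y) * g (T x) \<partial>lborel)"
      using shift[of "\<lambda>z. indicator A z * g (y + z)" y] by simp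
  qed
  also have "\<dots> = (\<integral>\<^sup>+x. (\<integral>\<^sup>+y. indicator A (T x - y) * g (T x) \<partial>lborel) \<partial>lborel)"
    by (rule lborel_pair.Fubini') measurable
  also have "\<dots> = (\<integral>\<^sup>+x. emeasure lborel A * g (T x) \<partial>lborel)"
    using refl[of "indicator A"] by (simp add: nn_integral_multc)
  also have "\<dots> = emeasure lborel A * integral\<^sup>N lborel g"
    by (simp add: nn_integral_cmult gT)
  finally have "emeasure (distr lborel borel T) A * integral\<^sup>N lborel g = emeasure lborel A * integral\<^sup>N lborel g" .
  moreover have "integral\<^sup>N lborel g \<noteq> 0" "integral\<^sup>N lborel g < \<top>"
    using content_ball_pos[of 1 "0::'e"] emeasure_lborel_ball_finite[of "0::'e" 1] by (auto simp: g_def measure_def)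
  ultimately show "emeasure (distr lborel borel T) A = emeasure lborel A"
    by (metis ennreal_mult_divide_eq less_irrefl)
qed simp

text \<open>Every real coordinate has variance 1, so on \<open>complex^'d\<close> each complex entry
  has mean square 2. The mean squared norm is therefore twice the complex dimension, which is the
  source of the factor 2 in 2 N N' s.\<close>

definition std_gaussian :: "'e::euclidean_space measure" where
  "std_gaussian = density lborel (\<lambda>x. ennreal ((1 / sqrt (2 * pi)) ^ DIM('e) * exp (- (norm x)\<^sup>2 / 2)))"

lemma sets_std_gaussian [simp, measurable_cong]: "sets std_gaussian = sets borel"
  by (simp add: std_gaussian_def)

lemma space_std_gaussian [simp]: "space std_gaussian = UNIV"
  by (simp add: std_gaussian_def)

lemma nn_integral_exp_quadratic:
  fixes a u :: real
  assumes "0 < a"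
  shows "(\<integral>\<^sup>+t. ennreal (1 / sqrt (2 * pi) * exp (- a * t\<^sup>2 / 2 + u * t)) \<partial>lborel)
    = ennreal (1 / sqrt a * exp (u\<^sup>2 / (2 * a)))"
proof -
  have *: "1 / sqrt (2 * pi) * exp (- a * t\<^sup>2 / 2 + u * t)
      = (1 / sqrt a * exp (u\<^sup>2 / (2 * a))) * normal_density (u / a) (1 / sqrt a) t" for t
  proof -
    have "- a * t\<^sup>2 / 2 + u * t = u\<^sup>2 / (2 * a) + - (t - u / a)\<^sup>2 / (2 * (1 / sqrt a)\<^sup>2)"
      using assms by (simp add: field_simps power2_eq_square)
    then have "exp (- a * t\<^sup>2 / 2 + u * t) = exp (u\<^sup>2 / (2 * a)) * exp (- (t - u / a)\<^sup>2 / (2 * (1 / sqrt a)\<^sup>2))"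
      by (simp only: exp_add)
    moreover have "1 / sqrt (2 * pi) = 1 / sqrt a * (1 / sqrt (2 * pi * (1 / sqrt a)\<^sup>2))"
      using assms by (simp add: real_sqrt_mult real_sqrt_divide power_divide)
    ultimately show ?thesis
      by (simp add: normal_density_def)
  qed
  have "(\<integral>\<^sup>+t. ennreal (normal_density (u / a) (1 / sqrt a) t) \<partial>lborel) = 1"
    using assms by (subst nn_integral_eq_integral) auto
  then show ?thesis
    unfolding * using assms by (subst ennreal_mult) (simp_all add: nn_integral_cmult)
qed

text \<open>The one Gaussian integral behind all later estimates, obtained by completing the square
  in each coordinate. With b = 0 and w = 0 it is the normalization, w carries the cross term created
  by a small rotation, and b alone integrates out the radius.\<close>

lemma nn_integral_std_gaussian_exp:
  fixes w :: "'e::euclidean_space"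
  assumes "b < 1/2"
  shows "(\<integral>\<^sup>+x. ennreal (exp (b * (norm x)\<^sup>2 + w \<bullet> x)) \<partial>std_gaussian)
    = ennreal ((1 / sqrt (1 - 2 * b)) ^ DIM('e) * exp ((norm w)\<^sup>2 / (2 * (1 - 2 * b))))"
proof -
  let ?a = "1 - 2 * b"
  have nrm: "(norm x)\<^sup>2 = (\<Sum>i\<in>Basis. (x \<bullet> i)\<^sup>2)" for x :: 'e
    unfolding power2_norm_eq_inner by (subst euclidean_inner) (simp add: power2_eq_square)
  have "(\<integral>\<^sup>+x. ennreal (exp (b * (norm x)\<^sup>2 + w \<bullet> x)) \<partial>std_gaussian)
    = (\<integral>\<^sup>+x. (\<Prod>i\<in>Basis. ennreal (1 / sqrt (2 * pi) * exp (- ?a * (x \<bullet> i)\<^sup>2 / 2 + (w \<bullet> i) * (x \<bullet> i)))) \<partial>(lborel :: 'e measure))"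
    unfolding std_gaussian_def
  proof (subst nn_integral_density, simp, simp, intro nn_integral_cong)
    fix x :: 'e
    have "- (norm x)\<^sup>2 / 2 + (b * (norm x)\<^sup>2 + w \<bullet> x) = (\<Sum>i\<in>Basis. - ?a * (x \<bullet> i)\<^sup>2 / 2 + (w \<bullet> i) * (x \<bullet> i))"
      unfolding nrm euclidean_inner[of w x] sum_distrib_left sum_negf[symmetric] sum_divide_distrib sum.distrib[symmetric]
      by (intro sum.cong refl) (simp add: field_simps)
    then have "exp (- (norm x)\<^sup>2 / 2) * exp (b * (norm x)\<^sup>2 + w \<bullet> x)
        = (\<Prod>i\<in>Basis. exp (- ?a * (x \<bullet> i)\<^sup>2 / 2 + (w \<bullet> i) * (x \<bullet> i)))"
      by (simp only: exp_sum finite_Basis flip: exp_add)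
    then show "ennreal ((1 / sqrt (2 * pi)) ^ DIM('e) * exp (- (norm x)\<^sup>2 / 2)) * ennreal (exp (b * (norm x)\<^sup>2 + w \<bullet> x))
      = (\<Prod>i\<in>Basis. ennreal (1 / sqrt (2 * pi) * exp (- ?a * (x \<bullet> i)\<^sup>2 / 2 + (w \<bullet> i) * (x \<bullet> i))))"
      by (simp only: prod.distrib prod_constant prod_ennreal mult.assoc less_imp_le exp_gt_zero mult_nonneg_nonneg real_sqrt_ge_zero
          divide_nonneg_nonneg zero_le_one pi_ge_zero zero_le_numeral zero_le_power flip: ennreal_mult)
  qed
  also have "\<dots> = (\<Prod>i\<in>(Basis::'e set). ennreal (1 / sqrt ?a * exp ((w \<bullet> i)\<^sup>2 / (2 * ?a))))"
    using assms by (subst nn_integral_lborel_prod) (simp_all only: nn_integral_exp_quadratic, auto)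
  also have "\<dots> = ennreal ((1 / sqrt ?a) ^ DIM('e) * (\<Prod>i\<in>(Basis::'e set). exp ((w \<bullet> i)\<^sup>2 / (2 * ?a))))"
    using assms by (subst prod_ennreal) (auto simp: prod.distrib prod_dividef power_one_over)
  also have "(\<Prod>i\<in>(Basis::'e set). exp ((w \<bullet> i)\<^sup>2 / (2 * ?a))) = exp ((norm w)\<^sup>2 / (2 * ?a))"
    by (simp add: nrm sum_divide_distrib exp_sum)
  finally show ?thesis .
qed

lemma prob_space_std_gaussian: "prob_space (std_gaussian :: 'e::euclidean_space measure)"
proof
  show "emeasure (std_gaussian :: 'e measure) (space std_gaussian) = 1"
    using nn_integral_std_gaussian_exp[of 0 "0::'e"] by simp
qed

lemma std_gaussian_prod:
  "std_gaussian \<Otimes>\<^sub>M std_gaussian = (std_gaussian :: ('e::euclidean_space \<times> 'f::euclidean_space) measure)"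
proof -
  interpret F: prob_space "std_gaussian :: 'f measure" by (rule prob_space_std_gaussian)
  show ?thesis
    unfolding std_gaussian_def
  proof (subst pair_measure_density)
    show "density (lborel \<Otimes>\<^sub>M lborel) (\<lambda>(x :: 'e, y :: 'f).
        ennreal ((1 / sqrt (2 * pi)) ^ DIM('e) * exp (- (norm x)\<^sup>2 / 2)) *
        ennreal ((1 / sqrt (2 * pi)) ^ DIM('f) * exp (- (norm y)\<^sup>2 / 2))) =
      density lborel (\<lambda>x. ennreal ((1 / sqrt (2 * pi)) ^ DIM('e \<times> 'f) * exp (- (norm x)\<^sup>2 / 2)))"
      unfolding lborel_prod
    proof (rule density_cong)
      have "(1 / sqrt (2 * pi)) ^ DIM('e \<times> 'f) * exp (- (norm (x, y))\<^sup>2 / 2) =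
         ((1 / sqrt (2 * pi)) ^ DIM('e) * exp (- (norm x)\<^sup>2 / 2)) *
         ((1 / sqrt (2 * pi)) ^ DIM('f) * exp (- (norm y)\<^sup>2 / 2))" for x :: 'e and y :: 'f
      proof -
        have "- (norm (x, y))\<^sup>2 / 2 = - (norm x)\<^sup>2 / 2 + - (norm y)\<^sup>2 / 2"
          by (simp add: norm_Pair add_divide_distrib)
        then show ?thesis
          by (simp only: exp_add DIM_prod power_add mult_ac)
      qed
      then show "AE p in lborel. (case p of (x :: 'e, y :: 'f) \<Rightarrow>
          ennreal ((1 / sqrt (2 * pi)) ^ DIM('e) * exp (- (norm x)\<^sup>2 / 2)) *
          ennreal ((1 / sqrt (2 * pi)) ^ DIM('f) * exp (- (norm y)\<^sup>2 / 2))) =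
        ennreal ((1 / sqrt (2 * pi)) ^ DIM('e \<times> 'f) * exp (- (norm p)\<^sup>2 / 2))"
        by (intro AE_I2) (simp only: split_paired_all case_prod_conv ennreal_mult'[symmetric] mult_nonneg_nonneg zero_le_power exp_ge_zero
            divide_nonneg_nonneg zero_le_one real_sqrt_ge_zero pi_ge_zero zero_le_numeral)
    qed (simp, simp add: borel_prod[symmetric], simp)
  qed (use F.sigma_finite_measure_axioms[unfolded std_gaussian_def] in \<open>simp_all add: sigma_finite_lborel\<close>)
qed

lemma distr_std_gaussian_isometry:
  fixes T :: "'e::euclidean_space \<Rightarrow> 'e"
  assumes lin: "linear T" and iso: "\<And>x. norm (T x) = norm x"
  shows "distr std_gaussian borel T = std_gaussian"
proof -
  have meas [measurable]: "T \<in> borel_measurable borel"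
    by (intro borel_measurable_continuous_onI linear_continuous_on linear_conv_bounded_linear[THEN iffD1] lin)
  have "std_gaussian = density (distr lborel borel T) (\<lambda>x. ennreal ((1 / sqrt (2 * pi)) ^ DIM('e) * exp (- (norm x)\<^sup>2 / 2)))"
    unfolding std_gaussian_def distr_lborel_isometry[OF assms] ..
  also have "\<dots> = distr (density lborel (\<lambda>x. ennreal ((1 / sqrt (2 * pi)) ^ DIM('e) * exp (- (norm (T x))\<^sup>2 / 2)))) borel T"
    by (subst density_distr) simp_all
  also have "\<dots> = distr std_gaussian borel T"
    unfolding iso std_gaussian_def ..
  finally show ?thesis by simp
qed

text \<open>A pair of independent Gaussian vectors is a single Gaussian vector on the product space,
  and the rotation is a linear isometry there; so the rotated pair is again independent with the
  same law.\<close>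

lemma nn_integral_std_gaussian_rotate:
  fixes F :: "'e::euclidean_space \<Rightarrow> 'e \<Rightarrow> ennreal"
  assumes F [measurable]: "case_prod F \<in> borel_measurable borel"
  shows "(\<integral>\<^sup>+x. (\<integral>\<^sup>+y. F (cos t *\<^sub>R x - sin t *\<^sub>R y) (sin t *\<^sub>R x + cos t *\<^sub>R y) \<partial>std_gaussian) \<partial>std_gaussian)
    = (\<integral>\<^sup>+x. (\<integral>\<^sup>+y. F x y \<partial>std_gaussian) \<partial>std_gaussian)"
proof -
  interpret F: prob_space "std_gaussian :: 'e measure" by (rule prob_space_std_gaussian)
  interpret P: pair_sigma_finite "std_gaussian :: 'e measure" "std_gaussian :: 'e measure" ..
  let ?T = "\<lambda>p :: 'e \<times> 'e. (cos t *\<^sub>R fst p - sin t *\<^sub>R snd p, sin t *\<^sub>R fst p + cos t *\<^sub>R snd p)"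
  have iterated: "(\<integral>\<^sup>+x. (\<integral>\<^sup>+y. G (x, y) \<partial>std_gaussian) \<partial>std_gaussian) = (\<integral>\<^sup>+p. G p \<partial>std_gaussian)"
    if "G \<in> borel_measurable borel" for G :: "'e \<times> 'e \<Rightarrow> ennreal"
  proof -
    have "G \<in> borel_measurable (std_gaussian \<Otimes>\<^sub>M std_gaussian)"
      unfolding std_gaussian_prod using that by simp
    then show ?thesis
      by (simp add: F.nn_integral_fst std_gaussian_prod)
  qed
  have lin: "linear ?T"
    by (rule linearI) (auto simp: algebra_simps)
  have iso: "norm (?T p) = norm p" for p
  proof -
    have "(norm (c *\<^sub>R x - s *\<^sub>R y, s *\<^sub>R x + c *\<^sub>R y))\<^sup>2 = (c\<^sup>2 + s\<^sup>2) * ((norm x)\<^sup>2 + (norm y)\<^sup>2)" for c s and x y :: 'e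
      unfolding power2_norm_eq_inner by (simp add: inner_simps algebra_simps power2_eq_square inner_commute)
    then have "(norm (?T p))\<^sup>2 = (norm p)\<^sup>2"
      by (simp add: norm_prod_def)
    then show ?thesis by simp
  qed
  have cont: "?T \<in> borel_measurable borel"
    by (intro borel_measurable_continuous_onI continuous_intros)
  have "(\<integral>\<^sup>+x. (\<integral>\<^sup>+y. F x y \<partial>std_gaussian) \<partial>std_gaussian) = (\<integral>\<^sup>+p. case_prod F p \<partial>std_gaussian)"
    using iterated[OF F] by simp
  also have "\<dots> = (\<integral>\<^sup>+p. case_prod F p \<partial>distr std_gaussian borel ?T)"
    by (simp only: distr_std_gaussian_isometry[OF lin iso])
  also have "\<dots> = (\<integral>\<^sup>+p. case_prod F (?T p) \<partial>std_gaussian)"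
    using cont by (subst nn_integral_distr) simp_all
  also have "\<dots> = (\<integral>\<^sup>+x. (\<integral>\<^sup>+y. case_prod F (?T (x, y)) \<partial>std_gaussian) \<partial>std_gaussian)"
    using cont by (intro iterated[symmetric] measurable_compose[OF cont F])
  finally show ?thesis by simp
qed

section \<open>Gaussian concentration of maxima of quadratic forms\<close>

lemma gaussian_mgf_factor_le:
  fixes b :: real
  assumes "0 \<le> b" "b \<le> 1/4"
  shows "(1 / sqrt (1 - 2 * b)) ^ m \<le> exp (2 * b * real m)"
proof -
  \<comment> \<open>The bound b \<le> 1/4 enters twice: as 2 b \<le> 1/2 for this lower bound on the
    logarithm, and as 8 b^2 \<le> 2 b to absorb the quadratic term.\<close>
  have "- (2 * b) - 2 * (2 * b)\<^sup>2 \<le> ln (1 - 2 * b)"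
    using assms by (intro ln_one_minus_pos_lower_bound) auto
  moreover have "2 * (2 * b)\<^sup>2 \<le> 2 * b"
    using assms mult_left_mono[of "4 * b" 1 "2 * b"] by (simp add: power2_eq_square)
  ultimately have "- 4 * b \<le> ln (1 - 2 * b)"
    by linarith
  then have "exp (- 4 * b) \<le> 1 - 2 * b"
    using assms by (simp add: ln_ge_iff)
  then have "sqrt (exp (- 4 * b)) \<le> sqrt (1 - 2 * b)"
    by (rule real_sqrt_le_mono)
  moreover have "sqrt (exp (- 4 * b)) = exp (- 2 * b)"
    by (rule real_sqrt_unique) (simp_all flip: exp_double)
  ultimately have "1 / sqrt (1 - 2 * b) \<le> 1 / exp (- 2 * b)"
    by (intro divide_left_mono) (use assms in \<open>auto simp del: real_sqrt_le_iff\<close>)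
  then have "1 / sqrt (1 - 2 * b) \<le> exp (2 * b)"
    by (simp add: exp_minus field_simps)
  then have "(1 / sqrt (1 - 2 * b)) ^ m \<le> exp (2 * b) ^ m"
    using assms by (intro power_mono) auto
  then show ?thesis
    by (simp add: exp_of_nat_mult[symmetric] mult.commute)
qed

text \<open>The form A optimal at x bounds f from below at the rotated point, so the decrease of f
  is at most that of the fixed form A: a cross term of first order in sin \<delta> plus terms of
  second order. Integrating out y turns the cross term into a multiple of (norm x)^2, and \<beta>'
  bounds everything that stands in front of (norm x)^2. A is picked separately for each x; this is
  harmless because the bound left after the y-integral depends on x only through its norm.\<close>

lemma nn_integral_gaussian_small_rotation:
  fixes f :: "'e::euclidean_space \<Rightarrow> real"
  assumes c: "0 \<le> c" and \<kappa>: "0 \<le> \<kappa>"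
    and f: "\<And>x. \<exists>A. linear A \<and> (\<forall>u v. u \<bullet> A v = A u \<bullet> v) \<and> (\<forall>v. norm (A v) \<le> c * norm v) \<and>
        f x = x \<bullet> A x \<and> (\<forall>y. y \<bullet> A y \<le> f y)"
    and \<beta>: "\<beta> = \<kappa> * c * (sin \<delta>)\<^sup>2" "\<beta> < 1/2"
    and \<beta>': "\<beta> + 2 * (\<kappa> * sin \<delta> * c)\<^sup>2 / (1 - 2 * \<beta>) \<le> \<beta>'" "\<beta>' < 1/2"
  shows "(\<integral>\<^sup>+x. (\<integral>\<^sup>+y. ennreal (exp (\<kappa> * (f x - f (cos \<delta> *\<^sub>R x - sin \<delta> *\<^sub>R y)))) \<partial>std_gaussian) \<partial>std_gaussian)
    \<le> ennreal ((1 / sqrt (1 - 2 * \<beta>)) ^ DIM('e) * (1 / sqrt (1 - 2 * \<beta>')) ^ DIM('e))"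
proof -
  let ?C = "cos \<delta>" and ?S = "sin \<delta>"
  let ?Z = "\<lambda>b. (1 / sqrt (1 - 2 * b)) ^ DIM('e)"
  have inner: "(\<integral>\<^sup>+y. ennreal (exp (\<kappa> * (f x - f (?C *\<^sub>R x - ?S *\<^sub>R y)))) \<partial>std_gaussian)
      \<le> ennreal (?Z \<beta>) * ennreal (exp (\<beta>' * (norm x)\<^sup>2 + 0 \<bullet> x))" for x
  proof -
    obtain A where A: "linear A" "\<And>u v. u \<bullet> A v = A u \<bullet> v" "\<And>v. norm (A v) \<le> c * norm v"
        "f x = x \<bullet> A x" "\<And>y. y \<bullet> A y \<le> f y"
      using f[of x] by blast
    interpret linear A by fact
    define w where "w = (2 * \<kappa> * ?C * ?S) *\<^sub>R A x"
    have quad: "\<bar>v \<bullet> A v\<bar> \<le> c * (norm v)\<^sup>2" for v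
    proof -
      have "\<bar>v \<bullet> A v\<bar> \<le> norm v * norm (A v)"
        by (rule Cauchy_Schwarz_ineq2)
      also have "\<dots> \<le> norm v * (c * norm v)"
        by (intro mult_left_mono A) simp
      finally show ?thesis by (simp add: power2_eq_square mult_ac)
    qed
    have "\<kappa> * (f x - f (?C *\<^sub>R x - ?S *\<^sub>R y)) \<le> (\<beta> * (norm y)\<^sup>2 + w \<bullet> y) + \<beta> * (norm x)\<^sup>2" for y
    proof -
      have "(?C *\<^sub>R x - ?S *\<^sub>R y) \<bullet> A (?C *\<^sub>R x - ?S *\<^sub>R y)
          = ?C\<^sup>2 * (x \<bullet> A x) - 2 * ?C * ?S * (A x \<bullet> y) + ?S\<^sup>2 * (y \<bullet> A y)"
        using A(2)[of y x] A(2)[of x y]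
        by (simp add: diff scale inner_simps power2_eq_square algebra_simps inner_commute)
      \<comment> \<open>Eliminating the squared cosine cancels the zeroth-order term x \<bullet> A x
        against f x.\<close>
      moreover have "?C\<^sup>2 = 1 - ?S\<^sup>2"
        by (simp add: cos_squared_eq)
      ultimately have "f x - (?C *\<^sub>R x - ?S *\<^sub>R y) \<bullet> A (?C *\<^sub>R x - ?S *\<^sub>R y)
          = ?S\<^sup>2 * (x \<bullet> A x) + 2 * ?C * ?S * (A x \<bullet> y) - ?S\<^sup>2 * (y \<bullet> A y)"
        by (simp add: A(4) algebra_simps)
      also have "\<dots> \<le> ?S\<^sup>2 * (c * (norm x)\<^sup>2) + 2 * ?C * ?S * (A x \<bullet> y) + ?S\<^sup>2 * (c * (norm y)\<^sup>2)"
      proof -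
        have "?S\<^sup>2 * (x \<bullet> A x) \<le> ?S\<^sup>2 * (c * (norm x)\<^sup>2)"
          using quad[of x] by (intro mult_left_mono) auto
        moreover have "?S\<^sup>2 * - (y \<bullet> A y) \<le> ?S\<^sup>2 * (c * (norm y)\<^sup>2)"
          using quad[of y] by (intro mult_left_mono) auto
        ultimately show ?thesis by simp
      qed
      finally have "f x - f (?C *\<^sub>R x - ?S *\<^sub>R y)
          \<le> ?S\<^sup>2 * (c * (norm x)\<^sup>2) + 2 * ?C * ?S * (A x \<bullet> y) + ?S\<^sup>2 * (c * (norm y)\<^sup>2)"
        using A(5)[of "?C *\<^sub>R x - ?S *\<^sub>R y"] by linarith
      from mult_left_mono[OF this \<kappa>] show ?thesis
        by (simp add: \<beta>(1) w_def algebra_simps)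
    qed
    then have "(\<integral>\<^sup>+y. ennreal (exp (\<kappa> * (f x - f (?C *\<^sub>R x - ?S *\<^sub>R y)))) \<partial>std_gaussian)
        \<le> (\<integral>\<^sup>+y. ennreal (exp (\<beta> * (norm y)\<^sup>2 + w \<bullet> y)) * ennreal (exp (\<beta> * (norm x)\<^sup>2)) \<partial>std_gaussian)"
      by (intro nn_integral_mono) (simp add: ennreal_leI flip: ennreal_mult exp_add)
    also have "\<dots> = ennreal (?Z \<beta> * exp ((norm w)\<^sup>2 / (2 * (1 - 2 * \<beta>)))) * ennreal (exp (\<beta> * (norm x)\<^sup>2))"
      using \<beta>(2) by (subst nn_integral_multc) (simp_all add: nn_integral_std_gaussian_exp)
    also have "\<dots> = ennreal (?Z \<beta> * exp ((norm w)\<^sup>2 / (2 * (1 - 2 * \<beta>)) + \<beta> * (norm x)\<^sup>2))"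
      using \<beta>(2) by (simp add: exp_add mult_ac flip: ennreal_mult)
    also have "\<dots> \<le> ennreal (?Z \<beta> * exp (\<beta>' * (norm x)\<^sup>2))"
    proof -
      have "norm w \<le> 2 * \<kappa> * \<bar>?S\<bar> * (c * norm x)"
      proof -
        have "norm w = 2 * \<kappa> * \<bar>?C\<bar> * \<bar>?S\<bar> * norm (A x)"
          using \<kappa> by (simp add: w_def abs_mult)
        also have "\<dots> \<le> 2 * \<kappa> * 1 * \<bar>?S\<bar> * (c * norm x)"
          using \<kappa> c by (intro mult_mono A) auto
        finally show ?thesis by simp
      qed
      then have "(norm w)\<^sup>2 \<le> (2 * \<kappa> * \<bar>?S\<bar> * (c * norm x))\<^sup>2"
        by (intro power_mono) auto
      also have "\<dots> = 4 * (\<kappa> * ?S * c)\<^sup>2 * (norm x)\<^sup>2"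
        by (simp add: power_mult_distrib)
      finally have "(norm w)\<^sup>2 / (2 * (1 - 2 * \<beta>)) \<le> 4 * (\<kappa> * ?S * c)\<^sup>2 * (norm x)\<^sup>2 / (2 * (1 - 2 * \<beta>))"
        using \<beta>(2) by (intro divide_right_mono) auto
      then have "(norm w)\<^sup>2 / (2 * (1 - 2 * \<beta>)) + \<beta> * (norm x)\<^sup>2
          \<le> (\<beta> + 2 * (\<kappa> * ?S * c)\<^sup>2 / (1 - 2 * \<beta>)) * (norm x)\<^sup>2"
        using \<beta>(2) by (simp add: field_simps)
      also have "\<dots> \<le> \<beta>' * (norm x)\<^sup>2"
        by (intro mult_right_mono \<beta>') simp
      finally show ?thesis
        using \<beta>(2) by (intro ennreal_leI mult_left_mono) auto
    qed
    also have "\<dots> = ennreal (?Z \<beta>) * ennreal (exp (\<beta>' * (norm x)\<^sup>2 + 0 \<bullet> x))"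
      using \<beta>(2) by (simp add: ennreal_mult)
    finally show ?thesis .
  qed
  have "(\<integral>\<^sup>+x. (\<integral>\<^sup>+y. ennreal (exp (\<kappa> * (f x - f (?C *\<^sub>R x - ?S *\<^sub>R y)))) \<partial>std_gaussian) \<partial>std_gaussian)
    \<le> (\<integral>\<^sup>+x. ennreal (?Z \<beta>) * ennreal (exp (\<beta>' * (norm x)\<^sup>2 + 0 \<bullet> x)) \<partial>(std_gaussian :: 'e measure))"
    by (rule nn_integral_mono) (rule inner)
  also have "\<dots> = ennreal (?Z \<beta>) * (\<integral>\<^sup>+x. ennreal (exp (\<beta>' * (norm x)\<^sup>2 + 0 \<bullet> x)) \<partial>(std_gaussian :: 'e measure))"
    by (subst nn_integral_cmult) simp_all
  also have "\<dots> = ennreal (?Z \<beta> * ?Z \<beta>')"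
    unfolding nn_integral_std_gaussian_exp[OF \<beta>'(2)] using \<beta>(2) \<beta>'(2) by (simp add: ennreal_mult)
  finally show ?thesis .
qed

text \<open>Jensen's inequality with K equal weights. The factor K that appears in the exponent is
  compensated later by increments of size about 1 / K.\<close>

lemma exp_sum_le_average_exp:
  fixes a :: "nat \<Rightarrow> real"
  assumes "0 < K"
  shows "exp (s * (\<Sum>k<K. a k)) \<le> (\<Sum>k<K. exp (s * real K * a k)) / real K"
proof -
  have "exp (\<Sum>k<K. (1 / real K) *\<^sub>R (s * real K * a k)) \<le> (\<Sum>k<K. (1 / real K) * exp (s * real K * a k))"
    using assms by (intro convex_on_sum[where C=UNIV and f=exp] exp_convex) auto
  also have "(\<Sum>k<K. (1 / real K) *\<^sub>R (s * real K * a k)) = s * (\<Sum>k<K. a k)"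
    using assms by (simp add: sum_distrib_left)
  also have "(\<Sum>k<K. (1 / real K) * exp (s * real K * a k)) = (\<Sum>k<K. exp (s * real K * a k)) / real K"
    by (simp add: sum_divide_distrib)
  finally show ?thesis .
qed

text \<open>A discrete quarter turn. The pairs (X, Y) at the angles k * \<delta> all have the law of
  (x, y), and a further turn by \<delta> takes X to its next position; so the K summands left by
  Jensen's inequality all have the same expectation, and their average is a single one.\<close>

lemma nn_integral_gaussian_chain:
  fixes f :: "'e::euclidean_space \<Rightarrow> real"
  assumes f: "f \<in> borel_measurable borel" and even: "\<And>x. f (- x) = f x" and K: "0 < K"
  defines "\<delta> \<equiv> pi / (2 * real K)"
  shows "(\<integral>\<^sup>+x. (\<integral>\<^sup>+y. ennreal (exp (s * (f x - f y))) \<partial>std_gaussian) \<partial>std_gaussian)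
    \<le> (\<integral>\<^sup>+x. (\<integral>\<^sup>+y. ennreal (exp (s * real K * (f x - f (cos \<delta> *\<^sub>R x - sin \<delta> *\<^sub>R y)))) \<partial>std_gaussian) \<partial>std_gaussian)"
proof -
  interpret G: prob_space "std_gaussian :: 'e measure" by (rule prob_space_std_gaussian)
  define F where "F x y = ennreal (exp (s * real K * (f x - f (cos \<delta> *\<^sub>R x - sin \<delta> *\<^sub>R y))))" for x y
  define X where "X t x y = cos t *\<^sub>R x - sin t *\<^sub>R y" for t and x y :: 'e
  define Y where "Y t x y = sin t *\<^sub>R x + cos t *\<^sub>R y" for t and x y :: 'e
  have F: "case_prod F \<in> borel_measurable borel"
    unfolding F_def borel_prod[symmetric] using f by (auto simp: case_prod_beta)
  have F' [measurable]: "(\<lambda>p. F (X t (fst p) (snd p)) (Y t (fst p) (snd p))) \<in> borel_measurable (borel \<Otimes>\<^sub>M borel)" for t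
    unfolding F_def X_def Y_def using f by simp
  have step: "cos \<delta> *\<^sub>R X (real k * \<delta>) x y - sin \<delta> *\<^sub>R Y (real k * \<delta>) x y = X (real (Suc k) * \<delta>) x y" for k x y
    by (simp add: X_def Y_def cos_add sin_add algebra_simps)
  have pt: "ennreal (exp (s * (f x - f y)))
      \<le> (\<Sum>k<K. ennreal (1 / real K) * F (X (real k * \<delta>) x y) (Y (real k * \<delta>) x y))" for x y
  proof -
    \<comment> \<open>The quarter turn ends at - y instead of y; evenness of f removes the
      sign.\<close>
    have "X (real K * \<delta>) x y = - y"
      using K by (simp add: X_def \<delta>_def)
    then have "f x - f y = f (X (real 0 * \<delta>) x y) - f (X (real K * \<delta>) x y)"
      by (simp add: even) (simp add: X_def)
    also have "\<dots> = (\<Sum>k<K. f (X (real k * \<delta>) x y) - f (X (real (Suc k) * \<delta>) x y))"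
      by (rule sum_lessThan_telescope'[symmetric])
    finally have "exp (s * (f x - f y))
        \<le> (\<Sum>k<K. exp (s * real K * (f (X (real k * \<delta>) x y) - f (X (real (Suc k) * \<delta>) x y)))) / real K"
      using exp_sum_le_average_exp[OF K] by simp
    then show ?thesis
      by (subst sum.cong[OF refl, where h="\<lambda>k. ennreal (exp (s * real K * (f (X (real k * \<delta>) x y) - f (X (real (Suc k) * \<delta>) x y))) / real K)"])
        (simp_all only: F_def step sum_divide_distrib ennreal_leI sum_ennreal divide_nonneg_nonneg exp_ge_zero of_nat_0_le_iff
          ennreal_mult[symmetric] zero_le_one mult_1 times_divide_eq_left)
  qed
  have "(\<integral>\<^sup>+x. (\<integral>\<^sup>+y. ennreal (exp (s * (f x - f y))) \<partial>std_gaussian) \<partial>std_gaussian)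
     \<le> (\<integral>\<^sup>+x. (\<integral>\<^sup>+y. (\<Sum>k<K. ennreal (1 / real K) * F (X (real k * \<delta>) x y) (Y (real k * \<delta>) x y)) \<partial>std_gaussian) \<partial>std_gaussian)"
    by (intro nn_integral_mono pt)
  also have "\<dots> = (\<Sum>k<K. ennreal (1 / real K) * (\<integral>\<^sup>+x. (\<integral>\<^sup>+y. F (X (real k * \<delta>) x y) (Y (real k * \<delta>) x y) \<partial>std_gaussian) \<partial>std_gaussian))"
  proof -
    have m1: "(\<lambda>y. F (X t x y) (Y t x y)) \<in> borel_measurable std_gaussian" for t x
      using measurable_Pair2[OF F', of x t] by simp
    have m2: "(\<lambda>x. \<integral>\<^sup>+y. F (X t x y) (Y t x y) \<partial>std_gaussian) \<in> borel_measurable std_gaussian" for t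
      using F'[of t] by (intro G.borel_measurable_nn_integral) (simp add: case_prod_beta cong: measurable_cong_sets)
    show ?thesis
      using m1 m2 by (simp add: nn_integral_sum nn_integral_cmult)
  qed
  also have "\<dots> = (\<Sum>k<K. ennreal (1 / real K) * (\<integral>\<^sup>+x. (\<integral>\<^sup>+y. F x y \<partial>std_gaussian) \<partial>std_gaussian))"
    unfolding X_def Y_def nn_integral_std_gaussian_rotate[OF F] ..
  also have "\<dots> = (\<integral>\<^sup>+x. (\<integral>\<^sup>+y. F x y \<partial>std_gaussian) \<partial>std_gaussian)"
    using K by (simp add: ennreal_of_nat_eq_real_of_nat divide_ennreal_def mult.assoc[symmetric] flip: ennreal_mult)
  finally show ?thesis
    unfolding F_def .
qed

text \<open>By independence the product is the expectation of exp (s (f x - f y)), to which the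
  chain of rotations applies. The cross terms contribute order (s c)^2 whatever the number K of
  steps; taking K at least 2 / (s c) brings the second-order terms, which decrease like 1 / K, down
  to that order as well.\<close>

lemma gaussian_quadratic_max_concentration:
  fixes f :: "'e::euclidean_space \<Rightarrow> real"
  assumes s: "0 < s" and c: "0 < c" and sc: "(s * c)\<^sup>2 \<le> 1/40"
    and meas: "f \<in> borel_measurable borel"
    and f: "\<And>x. \<exists>A. linear A \<and> (\<forall>u v. u \<bullet> A v = A u \<bullet> v) \<and> (\<forall>v. norm (A v) \<le> c * norm v) \<and>
        f x = x \<bullet> A x \<and> (\<forall>y. y \<bullet> A y \<le> f y)"
  shows "(\<integral>\<^sup>+x. ennreal (exp (s * f x)) \<partial>std_gaussian) * (\<integral>\<^sup>+x. ennreal (exp (- s * f x)) \<partial>std_gaussian)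
    \<le> ennreal (exp (20 * real DIM('e) * (s * c)\<^sup>2))"
proof -
  define r where "r = s * c"
  have r: "0 < r" "r\<^sup>2 \<le> 1/40"
    using s c sc by (auto simp: r_def)
  have even: "f (- x) = f x" for x
  proof -
    have "f x \<le> f (- x)" for x
    proof -
      obtain A where "linear A" "f x = x \<bullet> A x" "\<forall>y. y \<bullet> A y \<le> f y"
        using f[of x] by blast
      then show ?thesis
        by (metis inner_minus_left inner_minus_right linear_neg minus_minus)
    qed
    from this[of x] this[of "- x"] show ?thesis by simp
  qed
  obtain K :: nat where K: "2 / r \<le> real K"
    using real_arch_simple by blast
  then have K0: "0 < K"
    using r by (metis divide_pos_pos gr0I linorder_not_less of_nat_0 zero_less_numeral)
  define \<delta> where "\<delta> = pi / (2 * real K)"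
  define \<kappa> where "\<kappa> = s * real K"
  define \<beta> where "\<beta> = \<kappa> * c * (sin \<delta>)\<^sup>2"
  have pi2: "pi\<^sup>2 \<le> 10"
  proof -
    have "pi\<^sup>2 \<le> (3.15)\<^sup>2"
      using pi_approx by (intro power_mono) auto
    then show ?thesis by (simp add: power2_eq_square)
  qed
  have sin2: "(sin \<delta>)\<^sup>2 \<le> \<delta>\<^sup>2"
    using abs_sin_x_le_abs_x[of \<delta>] by (simp add: abs_le_square_iff)
  \<comment> \<open>K * \<delta> is the quarter turn pi / 2, so this is the bound (pi / 2)^2 \<le>
    5/2.\<close>
  have Kd: "(real K * \<delta>)\<^sup>2 \<le> 5/2"
    using K0 pi2 by (simp add: \<delta>_def power_divide)
  have \<beta>0: "0 \<le> \<beta>"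
    using s c by (simp add: \<beta>_def \<kappa>_def)
  have \<beta>r: "\<beta> \<le> 5/4 * r\<^sup>2"
  proof -
    have "\<beta> * (2 / r) \<le> \<beta> * real K"
      by (intro mult_left_mono K \<beta>0)
    also have "\<dots> = r * ((real K)\<^sup>2 * (sin \<delta>)\<^sup>2)"
      by (simp add: \<beta>_def \<kappa>_def r_def power2_eq_square)
    also have "\<dots> \<le> r * ((real K)\<^sup>2 * \<delta>\<^sup>2)"
      using r sin2 by (intro mult_left_mono) auto
    also have "\<dots> \<le> r * (5/2)"
      using r Kd by (intro mult_left_mono) (auto simp: power_mult_distrib)
    finally show ?thesis
      using r by (simp add: field_simps power2_eq_square)
  qed
  have ks: "(\<kappa> * sin \<delta> * c)\<^sup>2 \<le> 5/2 * r\<^sup>2"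
  proof -
    have "(\<kappa> * sin \<delta> * c)\<^sup>2 = r\<^sup>2 * ((real K)\<^sup>2 * (sin \<delta>)\<^sup>2)"
      by (simp add: \<kappa>_def r_def power_mult_distrib mult_ac)
    also have "\<dots> \<le> r\<^sup>2 * ((real K)\<^sup>2 * \<delta>\<^sup>2)"
      using sin2 by (intro mult_left_mono) auto
    also have "\<dots> \<le> r\<^sup>2 * (5/2)"
      using Kd by (intro mult_left_mono) (auto simp: power_mult_distrib)
    finally show ?thesis by simp
  qed
  \<comment> \<open>Chosen to make \<beta> + \<beta>' exactly 10 r^2, hence the final exponent 20 m
    r^2. There is room for it: 2 \<beta> \<le> 5/2 r^2, and the cross term is at most 20/3 r^2
    because 1 - 2 \<beta> is at least 3/4. The assumption r^2 \<le> 1/40 is what keeps \<beta>'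
    within 1/4.\<close>
  let ?\<beta>' = "10 * r\<^sup>2 - \<beta>"
  have \<beta>': "\<beta> + 2 * (\<kappa> * sin \<delta> * c)\<^sup>2 / (1 - 2 * \<beta>) \<le> ?\<beta>'"
  proof -
    define t where "t = 2 * (\<kappa> * sin \<delta> * c)\<^sup>2 / (1 - 2 * \<beta>)"
    have "t \<le> 5 * r\<^sup>2 / (3/4)"
      unfolding t_def using ks \<beta>r r by (intro frac_le) auto
    then have "3 * t \<le> 20 * r\<^sup>2" "4 * \<beta> \<le> 5 * r\<^sup>2" "0 < r\<^sup>2"
      using \<beta>r r by simp_all
    then have "\<beta> + t \<le> ?\<beta>'"
      by linarith
    then show ?thesis
      by (simp only: t_def)
  qed
  have b1: "\<beta> \<le> 1/4" "?\<beta>' \<le> 1/4" "0 \<le> ?\<beta>'"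
    using \<beta>r \<beta>0 r by auto
  let ?m = "DIM('e)"
  have "(\<integral>\<^sup>+x. ennreal (exp (s * f x)) \<partial>std_gaussian) * (\<integral>\<^sup>+x. ennreal (exp (- s * f x)) \<partial>std_gaussian)
      = (\<integral>\<^sup>+x. (\<integral>\<^sup>+y. ennreal (exp (s * (f x - f y))) \<partial>std_gaussian) \<partial>std_gaussian)"
  proof -
    have [measurable]: "f \<in> borel_measurable std_gaussian"
      using meas by simp
    have "(\<integral>\<^sup>+y. ennreal (exp (s * (f x - f y))) \<partial>std_gaussian)
        = ennreal (exp (s * f x)) * (\<integral>\<^sup>+y. ennreal (exp (- s * f y)) \<partial>std_gaussian)" for x
      by (subst nn_integral_cmult[symmetric]) (simp_all add: algebra_simps flip: ennreal_mult exp_add)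
    then show ?thesis
      by (simp add: nn_integral_multc)
  qed
  also have "\<dots> \<le> ennreal ((1 / sqrt (1 - 2 * \<beta>)) ^ ?m * (1 / sqrt (1 - 2 * ?\<beta>')) ^ ?m)"
  proof (rule order_trans[OF nn_integral_gaussian_chain[OF meas even K0]])
    show "(\<integral>\<^sup>+x. (\<integral>\<^sup>+y. ennreal (exp (s * real K * (f x - f (cos (pi / (2 * real K)) *\<^sub>R x - sin (pi / (2 * real K)) *\<^sub>R y)))) \<partial>std_gaussian) \<partial>std_gaussian)
       \<le> ennreal ((1 / sqrt (1 - 2 * \<beta>)) ^ ?m * (1 / sqrt (1 - 2 * ?\<beta>')) ^ ?m)"
      unfolding \<delta>_def[symmetric] \<kappa>_def[symmetric]
      by (rule nn_integral_gaussian_small_rotation[where c=c])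
        (use c s f b1 \<beta>' in \<open>auto simp: \<beta>_def \<kappa>_def\<close>)
  qed
  also have "\<dots> \<le> ennreal (exp (2 * \<beta> * real ?m) * exp (2 * ?\<beta>' * real ?m))"
    using b1 \<beta>0 by (intro ennreal_leI mult_mono gaussian_mgf_factor_le) auto
  also have "exp (2 * \<beta> * real ?m) * exp (2 * ?\<beta>' * real ?m) = exp (20 * real ?m * (s * c)\<^sup>2)"
    by (simp add: r_def algebra_simps flip: exp_add)
  finally show ?thesis .
qed

section \<open>Unitarily invariant measures on the sphere\<close>

lemma unitary_group_adjoint: "V \<in> unitary_group \<Longrightarrow> adjoint_matrix V \<in> unitary_group"
  by (simp add: unitary_group_def)

lemma unitary_group_mult: "V \<in> unitary_group \<Longrightarrow> W \<in> unitary_group \<Longrightarrow> V ** W \<in> unitary_group"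
  unfolding unitary_group_def
  by (simp add: adjoint_matrix_mult) (metis matrix_mul_assoc matrix_mul_lid)

lemma adjoint_matrix_cinner:
  "(\<Sum>i\<in>UNIV. cnj (x $ i) * (A *v y) $ i) = (\<Sum>i\<in>UNIV. cnj ((adjoint_matrix A *v x) $ i) * y $ i)"
  by (simp add: matrix_vector_mult_def sum_distrib_left sum_distrib_right mult_ac) (rule sum.swap)

lemma cinner_self: "(\<Sum>i\<in>UNIV. cnj (x $ i) * x $ i) = complex_of_real ((norm x)\<^sup>2)"
  by (simp add: norm_vec_def L2_set_def sum_nonneg complex_norm_square mult.commute del: of_real_power)

lemma norm_unitary_mult:
  assumes "V \<in> unitary_group"
  shows "norm (V *v x) = norm x"
proof -
  have "complex_of_real ((norm (V *v x))\<^sup>2) = complex_of_real ((norm x)\<^sup>2)"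
    using assms unfolding cinner_self[symmetric] adjoint_matrix_cinner
    by (simp add: matrix_vector_mul_assoc unitary_group_def)
  then have "(norm (V *v x))\<^sup>2 = (norm x)\<^sup>2"
    using of_real_eq_iff by blast
  then show ?thesis by simp
qed

text \<open>A complex Householder reflection: V = I - w w^* / \<alpha> with w = u - v and \<alpha>
  the inner product of w with u. Equal norms give (norm w)^2 = \<alpha> + cnj \<alpha>, which is
  exactly the condition for V to be unitary. The familiar real denominator (norm w)^2 / 2 in place
  of \<alpha> would send u to v only if their inner product is real.\<close>

lemma unitary_group_transitive:
  fixes u v :: "complex^'d"
  assumes "norm u = norm v"
  obtains V where "V \<in> unitary_group" "V *v u = v"
proof (cases "u = v")
  case True
  then show thesis
    using that[OF mat_1_in_unitary_group] by simp
next
  case False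
  define w where "w = u - v"
  define \<alpha> where "\<alpha> = (\<Sum>k\<in>UNIV. cnj (w $ k) * u $ k)"
  have S: "(\<Sum>k\<in>UNIV. cnj (w $ k) * w $ k) = \<alpha> + cnj \<alpha>"
  proof -
    have "(\<Sum>k\<in>UNIV. cnj (u $ k) * u $ k) = (\<Sum>k\<in>UNIV. cnj (v $ k) * v $ k)"
      by (simp only: cinner_self assms)
    then show ?thesis
      by (simp add: \<alpha>_def w_def algebra_simps sum_subtractf sum.distrib)
  qed
  have "\<alpha> \<noteq> 0"
  proof
    assume "\<alpha> = 0"
    then have "complex_of_real ((norm w)\<^sup>2) = 0"
      using S by (simp only: cinner_self) simp
    then show False
      using False by (simp add: w_def)
  qed
  define V :: "complex^'d^'d" where "V = (\<chi> i j. (if i = j then 1 else 0) - w $ i * cnj (w $ j) / \<alpha>)"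
  have "V ** adjoint_matrix V = mat 1"
  proof -
    have "(V ** adjoint_matrix V) $ i $ j = mat 1 $ i $ j" for i j
    proof -
      have "(V ** adjoint_matrix V) $ i $ j
          = (\<Sum>k\<in>UNIV. (if i = k then (if j = k then 1 else 0) - cnj (w $ j) * w $ k / cnj \<alpha> else 0)
              - (if j = k then w $ i * cnj (w $ k) / \<alpha> else 0)
              + (w $ i * cnj (w $ j) / (\<alpha> * cnj \<alpha>)) * (cnj (w $ k) * w $ k))"
        using \<open>\<alpha> \<noteq> 0\<close> unfolding matrix_matrix_mult_def V_def by (auto intro!: sum.cong simp: field_simps)
      also have "\<dots> = (if j = i then 1 else 0) - cnj (w $ j) * w $ i / cnj \<alpha> - w $ i * cnj (w $ j) / \<alpha>
          + w $ i * cnj (w $ j) / (\<alpha> * cnj \<alpha>) * (\<alpha> + cnj \<alpha>)"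
        unfolding sum.distrib sum_subtractf sum_distrib_left[symmetric] S by simp
      also have "\<dots> = mat 1 $ i $ j"
        using \<open>\<alpha> \<noteq> 0\<close> by (simp add: mat_def field_simps)
      finally show ?thesis .
    qed
    then show ?thesis
      by (simp add: vec_eq_iff)
  qed
  then have "V \<in> unitary_group"
    using matrix_left_right_inverse by (auto simp: unitary_group_def)
  moreover have "V *v u = v"
  proof -
    have "(V *v u) $ i = v $ i" for i
    proof -
      have "(V *v u) $ i = (\<Sum>k\<in>UNIV. (if i = k then u $ k else 0) - w $ i / \<alpha> * (cnj (w $ k) * u $ k))"
        unfolding matrix_vector_mult_def V_def by (auto intro!: sum.cong simp: algebra_simps)
      also have "\<dots> = u $ i - w $ i / \<alpha> * \<alpha>"
        unfolding sum_subtractf sum_distrib_left[symmetric] \<alpha>_def[symmetric] by simp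
      finally show ?thesis
        using \<open>\<alpha> \<noteq> 0\<close> by (simp add: w_def)
    qed
    then show ?thesis
      by (simp add: vec_eq_iff)
  qed
  ultimately show thesis
    by (rule that)
qed

lemma norm_axis: "norm (axis k z :: complex^'d) = norm z"
proof -
  have "(\<Sum>i\<in>UNIV. (norm ((axis k z :: complex^'d) $ i))\<^sup>2) = (\<Sum>i\<in>UNIV. if i = k then (norm z)\<^sup>2 else 0)"
    by (intro sum.cong) (auto simp: axis_def)
  then show ?thesis
    by (simp add: norm_vec_def L2_set_def)
qed

section \<open>Second and fourth moments of a unitarily invariant random unit vector\<close>

locale unitary_invariant_sphere = prob_space \<nu> for \<nu> :: "(complex^'d) measure" +
  assumes sets_eq [measurable_cong]: "sets \<nu> = sets borel"
    and sphere: "AE x in \<nu>. norm x = 1"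
    and invariant: "V \<in> unitary_group \<Longrightarrow> distr \<nu> borel ((*v) V) = \<nu>"
begin

lemma borel_measurable_of_continuous:
  fixes f :: "complex^'d \<Rightarrow> 'c::topological_space"
  shows "continuous_on UNIV f \<Longrightarrow> f \<in> borel_measurable \<nu>"
  unfolding measurable_cong_sets[OF sets_eq refl] by (rule borel_measurable_continuous_onI)

lemma integrable_continuous:
  fixes f :: "complex^'d \<Rightarrow> 'c::{banach, second_countable_topology}"
  assumes "continuous_on UNIV f"
  shows "integrable \<nu> f"
proof -
  have "compact (f ` sphere 0 1)"
    using assms by (intro compact_continuous_image) (auto intro: continuous_on_subset)
  then obtain B where "\<And>x. norm x = 1 \<Longrightarrow> norm (f x) \<le> B"
    by (metis (no_types, lifting) bounded_iff compact_imp_bounded image_eqI mem_sphere_0)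
  moreover have "f \<in> borel_measurable \<nu>"
    using assms by (rule borel_measurable_of_continuous)
  ultimately show ?thesis
    using sphere by (intro integrable_const_bound[of _ B]) auto
qed

lemma integral_unitary_mult:
  fixes f :: "complex^'d \<Rightarrow> 'c::{banach, second_countable_topology}"
  assumes "V \<in> unitary_group" "continuous_on UNIV f"
  shows "(\<integral>x. f (V *v x) \<partial>\<nu>) = (\<integral>x. f x \<partial>\<nu>)"
proof -
  have "(*v) V \<in> measurable \<nu> borel"
    by (intro borel_measurable_of_continuous linear_continuous_on matrix_vector_mul_bounded_linear)
  then show ?thesis
    using assms by (subst (2) invariant[OF assms(1), symmetric], subst integral_distr)
      (auto intro: borel_measurable_continuous_onI)
qed

text \<open>A unitary matrix carrying u to v can be moved onto x by taking adjoints, and the law of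
  x absorbs it. Comparing suitable u and v then yields all the moments below.\<close>

lemma integral_cinner_power_eq:
  assumes "norm u = norm v"
  shows "(\<integral>x. norm (\<Sum>i\<in>UNIV. cnj (u $ i) * x $ i) ^ p \<partial>\<nu>) = (\<integral>x. norm (\<Sum>i\<in>UNIV. cnj (v $ i) * x $ i) ^ p \<partial>\<nu>)"
proof -
  obtain V where V: "V \<in> unitary_group" "V *v u = v"
    using unitary_group_transitive[OF assms] .
  have "(\<integral>x. norm (\<Sum>i\<in>UNIV. cnj (u $ i) * x $ i) ^ p \<partial>\<nu>)
      = (\<integral>x. norm (\<Sum>i\<in>UNIV. cnj (u $ i) * (adjoint_matrix V *v x) $ i) ^ p \<partial>\<nu>)"
    using unitary_group_adjoint[OF V(1)] by (intro integral_unitary_mult[symmetric] continuous_intros)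
  then show ?thesis
    unfolding adjoint_matrix_cinner by (simp add: V(2))
qed

text \<open>The sign change of one coordinate is a diagonal unitary matrix. This removes every
  moment in which some coordinate occurs an odd number of times.\<close>

lemma integral_odd_coordinate:
  fixes f :: "complex^'d \<Rightarrow> complex"
  assumes "continuous_on UNIV f"
    and odd: "\<And>x. f (\<chi> j. if j = i then - (x $ j) else x $ j) = - f x"
  shows "(\<integral>x. f x \<partial>\<nu>) = 0"
proof -
  define D :: "complex^'d^'d" where "D = (\<chi> j k. if j = k then (if j = i then - 1 else 1) else 0)"
  have "adjoint_matrix D = D"
    by (auto simp: D_def vec_eq_iff)
  moreover have "D ** D = mat 1"
  proof -
    have "(D ** D) $ j $ k = mat 1 $ j $ k" for j k
    proof -
      have "(D ** D) $ j $ k = (\<Sum>l\<in>UNIV. if j = l then (if l = k then 1 else 0) else 0)"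
        unfolding D_def matrix_matrix_mult_def vec_lambda_beta by (rule sum.cong) auto
      then show ?thesis
        by (simp add: mat_def)
    qed
    then show ?thesis
      by (simp add: vec_eq_iff)
  qed
  ultimately have "D \<in> unitary_group"
    by (simp add: unitary_group_def)
  moreover have "D *v x = (\<chi> j. if j = i then - (x $ j) else x $ j)" for x
  proof -
    have "(D *v x) $ j = (\<Sum>k\<in>UNIV. if j = k then (if k = i then - (x $ k) else x $ k) else 0)" for j
      unfolding D_def matrix_vector_mult_def vec_lambda_beta by (rule sum.cong) auto
    then show ?thesis
      by (simp add: vec_eq_iff)
  qed
  ultimately have "(\<integral>x. f x \<partial>\<nu>) = (\<integral>x. - f x \<partial>\<nu>)"
    using integral_unitary_mult[OF _ assms(1), of D] odd by simp
  then show ?thesis by simp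
qed

lemma sum_norm_square_coordinates: "AE x in \<nu>. (\<Sum>i\<in>UNIV. (norm (x $ i))\<^sup>2) = 1"
  using sphere by eventually_elim (simp add: norm_vec_def L2_set_def)

lemma cinner_axis: "(\<Sum>k\<in>UNIV. cnj ((axis i 1 :: complex^'d) $ k) * x $ k) = x $ i"
proof -
  have "(\<Sum>k\<in>UNIV. cnj ((axis i 1 :: complex^'d) $ k) * x $ k) = (\<Sum>k\<in>UNIV. if k = i then x $ k else 0)"
    by (intro sum.cong) (auto simp: axis_def)
  then show ?thesis by simp
qed

lemma integral_coordinate_power_eq: "(\<integral>x. norm (x $ i) ^ p \<partial>\<nu>) = (\<integral>x. norm (x $ j) ^ p \<partial>\<nu>)"
  using integral_cinner_power_eq[of "axis i 1" "axis j 1" p] by (simp add: cinner_axis)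

text \<open>On the diagonal, all coordinates have the same mean square and these add up to 1; off
  the diagonal, a sign change applies.\<close>

lemma integral_coordinate_product:
  "(\<integral>x. x $ i * cnj (x $ j) \<partial>\<nu>) = (if i = j then 1 / of_nat CARD('d) else 0)"
proof (cases "i = j")
  case True
  have int: "integrable \<nu> (\<lambda>x. norm (x $ k) ^ 2)" for k
    by (intro integrable_continuous continuous_intros)
  define e where "e = (\<integral>x. norm (x $ i) ^ 2 \<partial>\<nu>)"
  have e: "(\<integral>x. norm (x $ k) ^ 2 \<partial>\<nu>) = e" for k
    unfolding e_def by (rule integral_coordinate_power_eq)
  have "1 = (\<integral>x. (\<Sum>k\<in>UNIV. norm (x $ k) ^ 2) \<partial>\<nu>)"
    using sum_norm_square_coordinates by (subst integral_cong_AE[where g="\<lambda>_. 1"]) (auto simp: prob_space intro!: borel_measurable_of_continuous continuous_intros)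
  also have "\<dots> = (\<Sum>k\<in>(UNIV::'d set). e)"
    using int by (simp add: e)
  finally have "(\<integral>x. norm (x $ i) ^ 2 \<partial>\<nu>) = 1 / real CARD('d)"
    by (simp add: e field_simps)
  moreover have "(\<integral>x. x $ i * cnj (x $ i) \<partial>\<nu>) = complex_of_real (\<integral>x. norm (x $ i) ^ 2 \<partial>\<nu>)"
    by (simp only: complex_norm_square[symmetric] integral_complex_of_real)
  ultimately show ?thesis
    using True by simp
next
  case False
  then show ?thesis
    by (simp, intro integral_odd_coordinate[of _ i] continuous_intros) auto
qed

text \<open>Two relations determine these moments. The functional x_k + \<zeta> x_l has norm sqrt 2
  for every \<zeta> of modulus 1, hence fourth moment 4 b with b that of a single coordinate;
  summing over the four values 1, -1, \<i>, -\<i> of \<zeta> cancels the phases and leaves b / 2 for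
  the mixed moment. Squaring the identity that the squared moduli add up to 1 then fixes b.\<close>

lemma integral_coordinate_square_product:
  "(\<integral>x. (norm (x $ i))\<^sup>2 * (norm (x $ j))\<^sup>2 \<partial>\<nu>)
    = (if i = j then 2 else 1) / (real CARD('d) * (real CARD('d) + 1))"
proof -
  define b where "b = (\<integral>x. norm (x $ i) ^ 4 \<partial>\<nu>)"
  have b: "(\<integral>x. norm (x $ k) ^ 4 \<partial>\<nu>) = b" for k
    unfolding b_def by (rule integral_coordinate_power_eq)
  have int: "integrable \<nu> (\<lambda>x. (norm (x $ k))\<^sup>2 * (norm (x $ l))\<^sup>2)"
     "integrable \<nu> (\<lambda>x. norm (x $ k) ^ 4)" "integrable \<nu> (\<lambda>x. norm (x $ k + \<zeta> * x $ l) ^ 4)" for k l \<zeta>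
    by (intro integrable_continuous continuous_intros)+
  have off: "(\<integral>x. (norm (x $ k))\<^sup>2 * (norm (x $ l))\<^sup>2 \<partial>\<nu>) = b / 2" if "k \<noteq> l" for k l
  proof -
    have rot: "(\<integral>x. norm (x $ k + \<zeta> * x $ l) ^ 4 \<partial>\<nu>) = 4 * b" if "norm \<zeta> = 1" for \<zeta>
    proof -
      define u :: "complex^'d" where "u = axis k 1 + axis l (cnj \<zeta>)"
      have u: "(\<Sum>m\<in>UNIV. cnj (u $ m) * x $ m) = x $ k + \<zeta> * x $ l" for x
      proof -
        have "(\<Sum>m\<in>UNIV. cnj (u $ m) * x $ m) = (\<Sum>m\<in>UNIV. (if m = k then x $ m else 0) + (if m = l then \<zeta> * x $ m else 0))"
          by (intro sum.cong) (auto simp: u_def axis_def algebra_simps)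
        then show ?thesis by (simp add: sum.distrib)
      qed
      have "complex_of_real ((norm u)\<^sup>2) = u $ k + \<zeta> * u $ l"
        unfolding cinner_self[symmetric] u ..
      also have "\<dots> = 2"
        using \<open>k \<noteq> l\<close> that by (simp add: u_def axis_def complex_norm_square[symmetric])
      finally have "complex_of_real ((norm u)\<^sup>2) = complex_of_real 2"
        by simp
      then have "(norm u)\<^sup>2 = 2"
        by (simp only: of_real_eq_iff)
      then have "norm u = norm (axis k (complex_of_real (sqrt 2)) :: complex^'d)"
        using real_sqrt_unique[of "norm u" 2] by (simp add: norm_axis)
      moreover have axk: "(\<Sum>m\<in>UNIV. cnj ((axis k (complex_of_real (sqrt 2)) :: complex^'d) $ m) * x $ m)
          = complex_of_real (sqrt 2) * x $ k" for x
      proof -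
        have "(\<Sum>m\<in>UNIV. cnj ((axis k (complex_of_real (sqrt 2)) :: complex^'d) $ m) * x $ m)
            = (\<Sum>m\<in>UNIV. if m = k then complex_of_real (sqrt 2) * x $ m else 0)"
          by (intro sum.cong) (auto simp: axis_def)
        then show ?thesis by simp
      qed
      ultimately have "(\<integral>x. norm (x $ k + \<zeta> * x $ l) ^ 4 \<partial>\<nu>) = (\<integral>x. norm (complex_of_real (sqrt 2) * x $ k) ^ 4 \<partial>\<nu>)"
        using integral_cinner_power_eq[of u "axis k (complex_of_real (sqrt 2))" 4] by (simp only: u axk)
      also have "\<dots> = (\<integral>x. 4 * norm (x $ k) ^ 4 \<partial>\<nu>)"
      proof -
        have "sqrt 2 ^ 4 = (4::real)"
          using power_mult[of "sqrt 2" 2 2] by simp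
        then show ?thesis
          by (simp add: norm_mult power_mult_distrib)
      qed
      finally show ?thesis
        using int b by simp
    qed
    have pol: "norm (y + z) ^ 4 + norm (y - z) ^ 4 + norm (y + \<i> * z) ^ 4 + norm (y - \<i> * z) ^ 4
        = 4 * (norm y ^ 4 + norm z ^ 4 + 4 * ((norm y)\<^sup>2 * (norm z)\<^sup>2))" for y z :: complex
    proof -
      have 4: "norm t ^ 4 = ((Re t)\<^sup>2 + (Im t)\<^sup>2)\<^sup>2" for t :: complex
        using power_mult[of "norm t" 2 2] by (simp add: cmod_power2)
      show ?thesis
        unfolding 4 cmod_power2 by (simp add: power2_eq_square algebra_simps)
    qed
    define g where "g \<zeta> x = norm (x $ k + \<zeta> * x $ l) ^ 4" for \<zeta> and x :: "complex^'d"
    have g: "integrable \<nu> (g \<zeta>)" "norm \<zeta> = 1 \<Longrightarrow> (\<integral>x. g \<zeta> x \<partial>\<nu>) = 4 * b" for \<zeta>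
      unfolding g_def using int(3) rot by auto
    have "(\<integral>x. g 1 x + g (- 1) x + g \<i> x + g (- \<i>) x \<partial>\<nu>) = 16 * b"
      by (simp add: g)
    moreover have "(\<integral>x. g 1 x + g (- 1) x + g \<i> x + g (- \<i>) x \<partial>\<nu>)
        = 8 * b + 16 * (\<integral>x. (norm (x $ k))\<^sup>2 * (norm (x $ l))\<^sup>2 \<partial>\<nu>)"
      using int b by (simp add: g_def pol)
    ultimately show ?thesis by simp
  qed
  have diag: "(\<integral>x. (norm (x $ k))\<^sup>2 * (norm (x $ k))\<^sup>2 \<partial>\<nu>) = b" for k
    using b[of k] by (simp flip: power_add)
  have pair: "(\<integral>x. (norm (x $ k))\<^sup>2 * (norm (x $ l))\<^sup>2 \<partial>\<nu>) = b / 2 + (if k = l then b / 2 else 0)" for k l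
    using off[of k l] diag[of k] by auto
  have "1 = (\<integral>x. (\<Sum>k\<in>UNIV. \<Sum>l\<in>UNIV. (norm (x $ k))\<^sup>2 * (norm (x $ l))\<^sup>2) \<partial>\<nu>)"
    unfolding sum_product[symmetric]
    using sum_norm_square_coordinates by (subst integral_cong_AE[where g="\<lambda>_. 1"]) (auto simp: prob_space intro!: borel_measurable_of_continuous continuous_intros)
  also have "\<dots> = (\<Sum>k\<in>(UNIV::'d set). \<Sum>l\<in>(UNIV::'d set). b / 2 + (if k = l then b / 2 else 0))"
    using int by (simp add: pair)
  also have "\<dots> = real CARD('d) * (real CARD('d) + 1) * (b / 2)"
    by (simp add: sum.distrib algebra_simps)
  finally have "1 = real CARD('d) * (real CARD('d) + 1) * (b / 2)" .
  moreover have "0 < real CARD('d) * (real CARD('d) + 1)"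
    by (intro mult_pos_pos add_pos_pos) simp_all
  moreover define q where "q = b / 2"
  ultimately have "q = 1 / (real CARD('d) * (real CARD('d) + 1))"
    by (metis less_irrefl mult.commute nonzero_eq_divide_eq)
  then show ?thesis
    unfolding pair q_def[symmetric] by simp
qed

end

section \<open>Haar measure and the orbit of a unit vector\<close>

lemma haar_unitary_measurable_id:
  assumes "haar_unitary M"
  shows "(\<lambda>U. U) \<in> measurable M borel"
  using assms unfolding haar_unitary_def
  by (simp add: measurable_restrict_space1 cong: measurable_cong_sets)

text \<open>Passes from images of sets, the form used in \<open>haar_unitary\<close>, to
  push-forward measures: multiplication by V maps the preimage of A back onto the part of A inside
  the group.\<close>

lemma haar_unitary_distr_left:
  fixes M :: "(complex^'d^'d) measure"
  assumes M: "haar_unitary M" and V: "V \<in> unitary_group"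
  shows "distr M borel (\<lambda>U. V ** U) = distr M borel (\<lambda>U. U)"
proof (rule measure_eqI)
  note [measurable] = haar_unitary_measurable_id[OF M]
  have cont: "(\<lambda>U. V ** U) \<in> borel_measurable borel"
    by (intro borel_measurable_continuous_onI continuous_on_matrix_mult continuous_intros)
  have mV: "(\<lambda>U. V ** U) \<in> measurable M borel"
    using measurable_compose[OF haar_unitary_measurable_id[OF M] cont] .
  have V': "adjoint_matrix V ** V = mat 1" "V ** adjoint_matrix V = mat 1"
    using V by (auto simp: unitary_group_def)
  fix A :: "(complex^'d^'d) set" assume "A \<in> sets (distr M borel (\<lambda>U. V ** U))"
  then have A: "A \<in> sets borel" by simp
  let ?B = "(\<lambda>U. V ** U) -` A \<inter> space M"
  have "(\<lambda>U. V ** U) ` ?B = A \<inter> space M"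
  proof (intro equalityI subsetI)
    fix U assume "U \<in> A \<inter> space M"
    then have "adjoint_matrix V ** U \<in> ?B" "U = V ** (adjoint_matrix V ** U)"
      using V V' haar_unitary_space[OF M]
      by (auto simp: matrix_mul_assoc intro: unitary_group_mult unitary_group_adjoint)
    then show "U \<in> (\<lambda>U. V ** U) ` ?B"
      by blast
  qed (use V haar_unitary_space[OF M] in \<open>auto intro: unitary_group_mult\<close>)
  moreover have "?B \<in> sets M"
    using measurable_sets[OF mV A] .
  ultimately have "emeasure M ?B = emeasure M (A \<inter> space M)"
    using M V unfolding haar_unitary_def by metis
  then show "emeasure (distr M borel (\<lambda>U. V ** U)) A = emeasure (distr M borel (\<lambda>U. U)) A"
    using A mV by (simp add: emeasure_distr)
qed simp

lemma haar_unitary_nn_integral_left: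
  fixes M :: "(complex^'d^'d) measure"
  assumes M: "haar_unitary M" and V: "V \<in> unitary_group" and F: "F \<in> borel_measurable borel"
  shows "(\<integral>\<^sup>+U. F (V ** U) \<partial>M) = (\<integral>\<^sup>+U. F U \<partial>M)"
proof -
  note mid = haar_unitary_measurable_id[OF M]
  have cont: "(\<lambda>U. V ** U) \<in> borel_measurable borel"
    by (intro borel_measurable_continuous_onI continuous_on_matrix_mult continuous_intros)
  have "(\<integral>\<^sup>+U. F (V ** U) \<partial>M) = (\<integral>\<^sup>+U. F U \<partial>distr M borel (\<lambda>U. V ** U))"
    using F measurable_compose[OF mid cont] by (simp add: nn_integral_distr)
  also have "\<dots> = (\<integral>\<^sup>+U. F U \<partial>M)"
    unfolding haar_unitary_distr_left[OF M V] using F mid by (simp add: nn_integral_distr)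
  finally show ?thesis .
qed

lemma continuous_on_matrix_vector_mult:
  fixes f :: "'t::topological_space \<Rightarrow> complex^'m^'n" and g :: "'t \<Rightarrow> complex^'m"
  assumes "continuous_on S f" "continuous_on S g"
  shows "continuous_on S (\<lambda>x. f x *v g x)"
  unfolding matrix_vector_mult_def by (intro continuous_intros assms)

lemma haar_unitary_orbit:
  fixes M :: "(complex^'d^'d) measure"
  assumes M: "haar_unitary M" and \<psi>: "norm \<psi> = 1"
  shows "unitary_invariant_sphere (distr M borel (\<lambda>U. U *v \<psi>))"
proof -
  interpret prob_space M
    using M by (simp add: haar_unitary_def)
  note mid = haar_unitary_measurable_id[OF M]
  have c: "(\<lambda>U. U *v x) \<in> borel_measurable borel" for x :: "complex^'d"
    by (intro borel_measurable_continuous_onI continuous_on_matrix_vector_mult continuous_intros)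
  have cV: "(*v) V \<in> borel_measurable borel" for V :: "complex^'d^'d"
    by (intro borel_measurable_continuous_onI continuous_on_matrix_vector_mult continuous_intros)
  have cVV: "(\<lambda>U. V ** U) \<in> borel_measurable borel" for V :: "complex^'d^'d"
    by (intro borel_measurable_continuous_onI continuous_on_matrix_mult continuous_intros)
  have m: "(\<lambda>U. U *v \<psi>) \<in> measurable M borel"
    using measurable_compose[OF mid c] .
  interpret D: prob_space "distr M borel (\<lambda>U. U *v \<psi>)"
    using m by (rule prob_space_distr)
  show ?thesis
  proof
    show "AE x in distr M borel (\<lambda>U. U *v \<psi>). norm x = 1"
      using m \<psi> haar_unitary_space[OF M] by (simp add: AE_distr_iff, intro AE_I2) (simp add: norm_unitary_mult)
    fix V :: "complex^'d^'d" assume V: "V \<in> unitary_group"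
    have "distr (distr M borel (\<lambda>U. U *v \<psi>)) borel ((*v) V) = distr M borel (\<lambda>U. (V ** U) *v \<psi>)"
      using m cV by (simp add: distr_distr comp_def matrix_vector_mul_assoc)
    also have "\<dots> = distr (distr M borel (\<lambda>U. V ** U)) borel (\<lambda>U. U *v \<psi>)"
      by (subst distr_distr[OF c measurable_compose[OF mid cVV]]) (simp add: comp_def)
    also have "\<dots> = distr M borel (\<lambda>U. U *v \<psi>)"
      unfolding haar_unitary_distr_left[OF M V] by (subst distr_distr[OF c mid]) (simp add: comp_def)
    finally show "distr (distr M borel (\<lambda>U. U *v \<psi>)) borel ((*v) V) = distr M borel (\<lambda>U. U *v \<psi>)" .
  qed simp
qed

section \<open>Ergotropy of reduced pure states\<close>

text \<open>The operator K tensor identity: K acts on the first factor of the index pair.\<close>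

definition lift_matrix :: "complex^'a^'a \<Rightarrow> complex^('a::finite \<times> 'b::finite) \<Rightarrow> complex^('a \<times> 'b)" where
  "lift_matrix K x = (\<chi> p. \<Sum>j\<in>UNIV. K $ fst p $ j * x $ (j, snd p))"

abbreviation reduced_pure_state :: "complex^('a::finite \<times> 'b::finite) \<Rightarrow> complex^'a^'a" where
  "reduced_pure_state x \<equiv> partial_trace_B (rank_one_projector x)"

lemma reduced_pure_state_nth:
  "reduced_pure_state x $ i $ j = (\<Sum>k\<in>UNIV. x $ (i, k) * cnj (x $ (j, k)))"
  by (simp add: partial_trace_B_def rank_one_projector_def)

lemma sum_UNIV_prod: "(\<Sum>p\<in>(UNIV :: ('a::finite \<times> 'b::finite) set). g p) = (\<Sum>i\<in>UNIV. \<Sum>k\<in>UNIV. g (i, k))"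
  by (simp add: sum.cartesian_product)

text \<open>On complex vectors \<bullet> is the real part of the Hermitian inner product, so the
  expectation of K tensor identity becomes a quadratic form on a real Euclidean space, the setting
  of the Gaussian estimates.\<close>

lemma trace_reduced_pure_state:
  "Re (trace (K ** reduced_pure_state x)) = x \<bullet> lift_matrix K x"
proof -
  have "trace (K ** reduced_pure_state x) = (\<Sum>i\<in>UNIV. \<Sum>j\<in>UNIV. \<Sum>k\<in>UNIV. cnj (x $ (i, k)) * (K $ i $ j * x $ (j, k)))"
    by (simp add: trace_def matrix_matrix_mult_def reduced_pure_state_nth sum_distrib_left mult_ac)
  also have "\<dots> = (\<Sum>i\<in>UNIV. \<Sum>k\<in>UNIV. \<Sum>j\<in>UNIV. cnj (x $ (i, k)) * (K $ i $ j * x $ (j, k)))"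
    by (intro sum.cong refl sum.swap)
  also have "\<dots> = (\<Sum>p\<in>UNIV. cnj (x $ p) * lift_matrix K x $ p)"
    by (simp add: sum_UNIV_prod lift_matrix_def sum_distrib_left)
  finally show ?thesis
    by (simp add: inner_vec_def inner_complex_def)
qed

lemma linear_lift_matrix: "linear (lift_matrix K)"
  by (rule linearI) (simp_all add: lift_matrix_def vec_eq_iff distrib_left sum.distrib scaleR_sum_right)

lemma lift_matrix_symmetric:
  assumes "hermitian K"
  shows "u \<bullet> lift_matrix K v = lift_matrix K u \<bullet> v"
proof -
  have K: "cnj (K $ i $ j) = K $ j $ i" for i j
    using assms unfolding hermitian_def by (metis adjoint_matrix_nth)
  have "(\<Sum>p\<in>UNIV. cnj (u $ p) * lift_matrix K v $ p)
      = (\<Sum>i\<in>UNIV. \<Sum>k\<in>UNIV. \<Sum>j\<in>UNIV. cnj (u $ (i, k)) * (K $ i $ j * v $ (j, k)))"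
    by (simp add: sum_UNIV_prod lift_matrix_def sum_distrib_left)
  also have "\<dots> = (\<Sum>k\<in>UNIV. \<Sum>i\<in>UNIV. \<Sum>j\<in>UNIV. cnj (u $ (i, k)) * (K $ i $ j * v $ (j, k)))"
    by (rule sum.swap)
  also have "\<dots> = (\<Sum>k\<in>UNIV. \<Sum>j\<in>UNIV. \<Sum>i\<in>UNIV. cnj (u $ (i, k)) * (K $ i $ j * v $ (j, k)))"
    by (intro sum.cong refl sum.swap)
  also have "\<dots> = (\<Sum>j\<in>UNIV. \<Sum>k\<in>UNIV. \<Sum>i\<in>UNIV. cnj (u $ (i, k)) * (K $ i $ j * v $ (j, k)))"
    by (rule sum.swap)
  also have "\<dots> = (\<Sum>p\<in>UNIV. cnj (lift_matrix K u $ p) * v $ p)"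
    by (simp add: sum_UNIV_prod lift_matrix_def sum_distrib_right sum_distrib_left K mult_ac)
  finally have "Re (\<Sum>p\<in>UNIV. cnj (u $ p) * lift_matrix K v $ p) = Re (\<Sum>p\<in>UNIV. cnj (lift_matrix K u $ p) * v $ p)"
    by (rule arg_cong)
  then show ?thesis
    by (simp add: inner_vec_def inner_complex_def)
qed

lemma norm_vec_square: "(norm (x :: complex^'n))\<^sup>2 = (\<Sum>i\<in>UNIV. (norm (x $ i))\<^sup>2)"
  by (simp add: norm_vec_def L2_set_def sum_nonneg)

text \<open>For each fixed index of the second factor, K acts on the corresponding column of x
  alone, and squared norms add over the columns.\<close>

lemma norm_lift_matrix_le:
  assumes K: "\<And>v. norm (K *v v) \<le> c * norm v" and c: "0 \<le> c"
  shows "norm (lift_matrix K x) \<le> c * norm x"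
proof -
  define col where "col k = (\<chi> i. x $ (i, k))" for k
  have norm_cols: "(norm y)\<^sup>2 = (\<Sum>k\<in>UNIV. (norm (\<chi> i. y $ (i, k)))\<^sup>2)" for y :: "complex^('a \<times> 'b)"
    unfolding norm_vec_square sum_UNIV_prod by simp (rule sum.swap)
  have "(norm (lift_matrix K x))\<^sup>2 = (\<Sum>k\<in>UNIV. (norm (K *v col k))\<^sup>2)"
    unfolding norm_cols by (simp add: lift_matrix_def matrix_vector_mult_def col_def)
  also have "\<dots> \<le> (\<Sum>k\<in>UNIV. (c * norm (col k))\<^sup>2)"
    by (intro sum_mono power_mono K) simp
  also have "\<dots> = (c * norm x)\<^sup>2"
    by (simp add: norm_cols[of x] power_mult_distrib sum_distrib_left col_def)
  finally show ?thesis
    using c by (auto intro: power2_le_imp_le)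
qed

lemma spectral_norm_bound: "norm (H *v v) \<le> spectral_norm H * norm v"
  unfolding spectral_norm_def by (rule onorm) simp

lemma spectral_norm_nonneg: "0 \<le> spectral_norm H"
  unfolding spectral_norm_def by (rule onorm_pos_le) simp

lemma norm_conj_mult_le:
  assumes "V \<in> unitary_group"
  shows "norm ((adjoint_matrix V ** H ** V) *v v) \<le> spectral_norm H * norm v"
proof -
  have "norm ((adjoint_matrix V ** H ** V) *v v) = norm (H *v (V *v v))"
    using norm_unitary_mult[OF unitary_group_adjoint[OF assms]] by (simp flip: matrix_vector_mul_assoc)
  also have "\<dots> \<le> spectral_norm H * norm v"
    using spectral_norm_bound[of H "V *v v"] by (simp add: norm_unitary_mult assms)
  finally show ?thesis .
qed

lemma hermitian_conj: "hermitian H \<Longrightarrow> hermitian (adjoint_matrix V ** H ** V)"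
  by (simp add: hermitian_def adjoint_matrix_mult matrix_mul_assoc)

lemma trace_conj: "trace (H ** (V ** \<rho> ** adjoint_matrix V)) = trace ((adjoint_matrix V ** H ** V) ** \<rho>)"
  using trace_mul_sym[of "H ** V ** \<rho>" "adjoint_matrix V"] by (simp add: matrix_mul_assoc)

lemma matrix_diff_rdistrib: "(A - B) ** C = A ** C - B ** (C :: complex^'n^'m)"
  by (simp add: vec_eq_iff matrix_matrix_mult_def sum_subtractf left_diff_distrib)

lemma matrix_diff_ldistrib: "A ** (B - C) = A ** B - A ** (C :: complex^'n^'m)"
  by (simp add: vec_eq_iff matrix_matrix_mult_def sum_subtractf right_diff_distrib)

lemma trace_extracted_work:
  "trace (H ** (\<rho> - V ** \<rho> ** adjoint_matrix V)) = trace ((H - adjoint_matrix V ** H ** V) ** \<rho>)"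
  by (simp add: matrix_diff_ldistrib matrix_diff_rdistrib trace_sub trace_conj)

section \<open>Ergotropy as a maximum of quadratic forms\<close>

lemma ergotropy_ge:
  assumes "W \<in> unitary_group"
  shows "Re (trace (H ** (\<rho> - W ** \<rho> ** adjoint_matrix W))) \<le> ergotropy H \<rho>"
  by (rule ergotropy_attained[of H \<rho>]) (use assms in blast)

lemma ergotropy_nonneg: "0 \<le> ergotropy H \<rho>"
proof -
  have "adjoint_matrix (mat 1 :: complex^'a^'a) = mat 1"
    by (simp add: vec_eq_iff mat_def)
  then have "Re (trace (H ** (\<rho> - \<rho>))) \<le> ergotropy H \<rho>"
    using ergotropy_ge[OF mat_1_in_unitary_group, of H \<rho>] by (simp del: diff_self)
  moreover have "trace (H ** (\<rho> - \<rho>)) = 0"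
    by (simp add: trace_def matrix_matrix_mult_def)
  ultimately show ?thesis
    by simp
qed

text \<open>The unitary V optimal at x supplies A = K tensor identity with K = H - V^* H V; at any
  other y the same V is merely a competitor. The conclusion has the shape of the hypothesis on f in
  \<open>gaussian_quadratic_max_concentration\<close>, with c =
  \<open>2 * spectral_norm H\<close>.\<close>

lemma ergotropy_quadratic_max:
  fixes H :: "complex^'a^'a" and x :: "complex^('a::finite \<times> 'b::finite)"
  assumes H: "hermitian H"
  shows "\<exists>A. linear A \<and> (\<forall>u v. u \<bullet> A v = A u \<bullet> v) \<and> (\<forall>v. norm (A v) \<le> 2 * spectral_norm H * norm v) \<and>
    ergotropy H (reduced_pure_state x) = x \<bullet> A x \<and>
    (\<forall>y. y \<bullet> A y \<le> ergotropy H (reduced_pure_state y))"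
proof -
  obtain V where V: "V \<in> unitary_group"
    "ergotropy H (reduced_pure_state x)
      = Re (trace (H ** (reduced_pure_state x - V ** reduced_pure_state x ** adjoint_matrix V)))"
    using ergotropy_attained[of H "reduced_pure_state x"] by blast
  define K where "K = H - adjoint_matrix V ** H ** V"
  have "y \<bullet> lift_matrix K y \<le> ergotropy H (reduced_pure_state y)" for y :: "complex^('a \<times> 'b)"
    unfolding trace_reduced_pure_state[symmetric] K_def trace_extracted_work[symmetric]
    by (rule ergotropy_ge[OF V(1)])
  moreover have "ergotropy H (reduced_pure_state x) = x \<bullet> lift_matrix K x"
    unfolding V(2) trace_extracted_work trace_reduced_pure_state K_def ..
  moreover have "hermitian K"
    using H hermitian_conj[OF H, of V] by (simp add: hermitian_def K_def vec_eq_iff)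
  moreover have "norm (lift_matrix K y) \<le> 2 * spectral_norm H * norm y" for y :: "complex^('a \<times> 'b)"
  proof (rule norm_lift_matrix_le)
    fix v
    have "norm (K *v v) \<le> norm (H *v v) + norm ((adjoint_matrix V ** H ** V) *v v)"
      unfolding K_def matrix_vector_mult_diff_rdistrib by (rule norm_triangle_ineq4)
    also have "\<dots> \<le> 2 * spectral_norm H * norm v"
      using spectral_norm_bound[of H v] norm_conj_mult_le[OF V(1), of H v] by simp
    finally show "norm (K *v v) \<le> 2 * spectral_norm H * norm v" .
  qed (simp add: spectral_norm_nonneg)
  ultimately show ?thesis
    using linear_lift_matrix lift_matrix_symmetric by blast
qed

text \<open>Each inequality comes from the form that is optimal at one of the two points, tested at
  the other.\<close>

lemma ergotropy_scaleR:
  fixes H :: "complex^'a^'a" and x :: "complex^('a::finite \<times> 'b::finite)"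
  assumes H: "hermitian H"
  shows "ergotropy H (reduced_pure_state (r *\<^sub>R x)) = r\<^sup>2 * ergotropy H (reduced_pure_state x)"
proof (rule antisym)
  obtain A where "linear A" "ergotropy H (reduced_pure_state (r *\<^sub>R x)) = (r *\<^sub>R x) \<bullet> A (r *\<^sub>R x)"
    "x \<bullet> A x \<le> ergotropy H (reduced_pure_state x)"
    using ergotropy_quadratic_max[OF H, of "r *\<^sub>R x"] by blast
  then show "ergotropy H (reduced_pure_state (r *\<^sub>R x)) \<le> r\<^sup>2 * ergotropy H (reduced_pure_state x)"
    using mult_left_mono[of "x \<bullet> A x" "ergotropy H (reduced_pure_state x)" "r\<^sup>2"]
    by (simp add: linear_scale power2_eq_square mult.assoc)
  obtain B where "linear B" "ergotropy H (reduced_pure_state x) = x \<bullet> B x"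
    "(r *\<^sub>R x) \<bullet> B (r *\<^sub>R x) \<le> ergotropy H (reduced_pure_state (r *\<^sub>R x))"
    using ergotropy_quadratic_max[OF H, of x] by blast
  then show "r\<^sup>2 * ergotropy H (reduced_pure_state x) \<le> ergotropy H (reduced_pure_state (r *\<^sub>R x))"
    by (simp add: linear_scale power2_eq_square mult.assoc)
qed

lemma ergotropy_le:
  fixes H :: "complex^'a^'a" and x :: "complex^('a::finite \<times> 'b::finite)"
  assumes H: "hermitian H"
  shows "ergotropy H (reduced_pure_state x) \<le> 2 * spectral_norm H * (norm x)\<^sup>2"
proof -
  obtain A where A: "norm (A x) \<le> 2 * spectral_norm H * norm x" "ergotropy H (reduced_pure_state x) = x \<bullet> A x"
    using ergotropy_quadratic_max[OF H, of x] by blast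
  have "x \<bullet> A x \<le> norm x * norm (A x)"
    by (rule norm_cauchy_schwarz)
  also have "\<dots> \<le> norm x * (2 * spectral_norm H * norm x)"
    by (intro mult_left_mono A) simp
  finally show ?thesis
    by (simp add: A(2) power2_eq_square mult_ac)
qed

text \<open>A supremum of continuous functions is lower semicontinuous. The supremum is taken over
  all linear maps whose quadratic form stays below the ergotropy; the form optimal at a given point
  is among them.\<close>

lemma borel_measurable_ergotropy:
  fixes H :: "complex^'a^'a"
  assumes H: "hermitian H"
  shows "(\<lambda>x :: complex^('a::finite \<times> 'b::finite). ergotropy H (reduced_pure_state x)) \<in> borel_measurable borel"
proof (rule borel_measurableI_greater)
  fix t
  let ?f = "\<lambda>x :: complex^('a \<times> 'b). ergotropy H (reduced_pure_state x)"
  let ?S = "{A :: complex^('a \<times> 'b) \<Rightarrow> complex^('a \<times> 'b). linear A \<and> (\<forall>y. y \<bullet> A y \<le> ?f y)}"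
  have "t < ?f x \<longleftrightarrow> (\<exists>A\<in>?S. t < x \<bullet> A x)" for x
  proof
    assume "t < ?f x"
    moreover obtain A where "linear A" "?f x = x \<bullet> A x" "\<forall>y. y \<bullet> A y \<le> ?f y"
      using ergotropy_quadratic_max[OF H, of x] by blast
    ultimately show "\<exists>A\<in>?S. t < x \<bullet> A x"
      by (intro bexI[of _ A]) auto
  qed (use order_less_le_trans in blast)
  then have "{x. t < ?f x} = (\<Union>A\<in>?S. {x. t < x \<bullet> A x})"
    by blast
  moreover have "open (\<Union>A\<in>?S. {x. t < x \<bullet> A x})"
    by (intro open_UN ballI open_Collect_less continuous_intros linear_continuous_on)
      (auto simp: linear_conv_bounded_linear)
  ultimately show "{x \<in> space borel. t < ?f x} \<in> sets borel"
    by simp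
qed

text \<open>Tr (H \<rho>) is kept as it stands, because its mean over the sphere is exactly Tr H / N
  and cancels. Only the term of K = V^* H V is estimated: K has the trace of H, so what remains is
  the Hilbert-Schmidt product of K with the deviation of \<rho> from the maximally mixed state,
  bounded by Cauchy-Schwarz.\<close>

lemma ergotropy_le_deviation:
  fixes H :: "complex^'a^'a" and \<rho> :: "complex^'a^'a"
  assumes H: "hermitian H" and tr: "trace \<rho> = 1"
  shows "ergotropy H \<rho> \<le> Re (trace (H ** \<rho>)) - Re (trace H) / real CARD('a)
    + spectral_norm H * sqrt (real CARD('a)) * norm (\<rho> - mat (1 / of_nat CARD('a)))"
proof -
  obtain V where V: "V \<in> unitary_group"
    "ergotropy H \<rho> = Re (trace (H ** (\<rho> - V ** \<rho> ** adjoint_matrix V)))"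
    using ergotropy_attained[of H \<rho>] by blast
  define K where "K = adjoint_matrix V ** H ** V"
  define X where "X = \<rho> - mat (1 / of_nat CARD('a))"
  have Kc: "cnj (K $ i $ j) = K $ j $ i" for i j
    using hermitian_conj[OF H, of V] unfolding hermitian_def K_def by (metis adjoint_matrix_nth)
  have trK: "trace K = trace H"
    using trace_mul_sym[of "adjoint_matrix V ** H" V] trace_mul_sym[of V "adjoint_matrix V ** H"] V(1)
    by (simp add: K_def matrix_mul_assoc unitary_group_def)
  have tr_mat: "trace (K ** mat z) = z * trace K" for z
  proof -
    have "(K ** mat z) $ i $ i = z * K $ i $ i" for i
    proof -
      have "(K ** mat z) $ i $ i = (\<Sum>k\<in>UNIV. if k = i then z * K $ i $ k else 0)"
        unfolding matrix_matrix_mult_def mat_def vec_lambda_beta by (rule sum.cong) auto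
      then show ?thesis by simp
    qed
    then show ?thesis
      by (simp add: trace_def sum_distrib_left)
  qed
  have "trace (K ** X) = trace (K ** \<rho>) - trace H / of_nat CARD('a)"
    by (simp add: X_def matrix_diff_ldistrib trace_sub tr_mat trK)
  then have tr_X: "Re (trace (K ** \<rho>)) = Re (trace (K ** X)) + Re (trace H) / real CARD('a)"
    by simp
  have "ergotropy H \<rho> = Re (trace (H ** \<rho>)) - Re (trace (K ** \<rho>))"
    by (simp add: V(2) trace_extracted_work matrix_diff_rdistrib trace_sub K_def)
  then have "ergotropy H \<rho> = Re (trace (H ** \<rho>)) - Re (trace H) / real CARD('a) - Re (trace (K ** X))"
    by (simp add: tr_X)
  moreover have "- Re (trace (K ** X)) \<le> spectral_norm H * sqrt (real CARD('a)) * norm X"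
  proof -
    have "trace (K ** X) = (\<Sum>i\<in>UNIV. \<Sum>j\<in>UNIV. cnj (K $ j $ i) * X $ j $ i)"
      by (simp add: trace_def matrix_matrix_mult_def Kc)
    also have "\<dots> = (\<Sum>j\<in>UNIV. \<Sum>i\<in>UNIV. cnj (K $ j $ i) * X $ j $ i)"
      by (rule sum.swap)
    finally have "Re (trace (K ** X)) = K \<bullet> X"
      by (simp add: inner_vec_def inner_complex_def)
    moreover have "\<bar>K \<bullet> X\<bar> \<le> norm K * norm X"
      by (rule Cauchy_Schwarz_ineq2)
    \<comment> \<open>\<open>norm\<close> on matrices is the Hilbert-Schmidt norm, and each of the N
      columns of K has length at most \<open>spectral_norm H\<close>.\<close>
    moreover have "norm K \<le> spectral_norm H * sqrt (real CARD('a))"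
    proof -
      have col: "(norm (K *v axis j 1))\<^sup>2 = (\<Sum>i\<in>UNIV. (norm (K $ i $ j))\<^sup>2)" for j
      proof -
        have "(K *v axis j 1) $ i = (\<Sum>k\<in>UNIV. if k = j then K $ i $ k else 0)" for i
          unfolding matrix_vector_mult_def axis_def vec_lambda_beta by (rule sum.cong) auto
        then show ?thesis
          by (simp add: norm_vec_square)
      qed
      have "(norm K)\<^sup>2 = (\<Sum>i\<in>UNIV. \<Sum>j\<in>UNIV. (norm (K $ i $ j))\<^sup>2)"
        by (simp add: norm_vec_def L2_set_def sum_nonneg)
      also have "\<dots> = (\<Sum>j\<in>UNIV. (norm (K *v axis j 1))\<^sup>2)"
        unfolding col by (rule sum.swap)
      also have "\<dots> \<le> (\<Sum>j\<in>(UNIV :: 'a set). (spectral_norm H)\<^sup>2)"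
        using norm_conj_mult_le[OF V(1), of H "axis _ 1"] unfolding K_def by (intro sum_mono power_mono) simp_all
      also have "\<dots> = (spectral_norm H * sqrt (real CARD('a)))\<^sup>2"
        by (simp add: power_mult_distrib)
      finally show ?thesis
        by (rule power2_le_imp_le) (simp add: spectral_norm_nonneg)
    qed
    ultimately show ?thesis
      using mult_right_mono[of "norm K" "spectral_norm H * sqrt (real CARD('a))" "norm X"] by simp
  qed
  ultimately show ?thesis
    unfolding X_def[symmetric] by linarith
qed

section \<open>Moments and concentration on the sphere\<close>

lemma integral_trace_reduced_pure_state:
  fixes \<nu> :: "(complex^('a::finite \<times> 'b::finite)) measure"
  assumes "unitary_invariant_sphere \<nu>"
  shows "(\<integral>x. Re (trace (H ** reduced_pure_state x)) \<partial>\<nu>) = Re (trace H) / real CARD('a)"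
proof -
  interpret unitary_invariant_sphere \<nu> by fact
  have int: "integrable \<nu> (\<lambda>x. x $ p * cnj (x $ q))" for p q
    by (intro integrable_continuous continuous_intros)
  have int': "integrable \<nu> (\<lambda>x. trace (H ** reduced_pure_state x))"
    unfolding trace_def matrix_matrix_mult_def
    by (simp add: reduced_pure_state_nth int)
  have "(\<integral>x. reduced_pure_state x $ j $ i \<partial>\<nu>) = (if j = i then 1 / of_nat CARD('a) else 0)" for i j
    by (simp add: reduced_pure_state_nth int integral_coordinate_product)
  moreover have "integrable \<nu> (\<lambda>x. reduced_pure_state x $ j $ i)" for i j
    by (simp add: reduced_pure_state_nth int)
  ultimately have "(\<integral>x. trace (H ** reduced_pure_state x) \<partial>\<nu>) = (\<Sum>i\<in>UNIV. \<Sum>j\<in>UNIV. H $ i $ j * (if j = i then 1 / of_nat CARD('a) else 0))"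
    by (simp add: trace_def matrix_matrix_mult_def)
  also have "\<dots> = (\<Sum>i\<in>UNIV. \<Sum>j\<in>UNIV. if j = i then H $ i $ j / of_nat CARD('a) else 0)"
    by (intro sum.cong) auto
  also have "\<dots> = trace H / of_nat CARD('a)"
    by (simp add: trace_def sum_divide_distrib)
  finally show ?thesis
    using int' by simp
qed

text \<open>This is the mean purity of a random bipartite pure state. A fourth-order monomial
  survives only if its coordinates pair up, that is for i = j or k = l. Where both hold, the doubled
  moment of a single coordinate is just the sum of the two contributions, so counting gives N N' (N
  + N') equal terms.\<close>

lemma integral_norm_reduced_pure_state:
  fixes \<nu> :: "(complex^('a::finite \<times> 'b::finite)) measure"
  assumes "unitary_invariant_sphere \<nu>"
  shows "(\<integral>x. (norm (reduced_pure_state x))\<^sup>2 \<partial>\<nu>)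
    = (real CARD('a) + real CARD('b)) / (real CARD('a) * real CARD('b) + 1)"
proof -
  interpret unitary_invariant_sphere \<nu> by fact
  let ?N = "real CARD('a)" and ?N' = "real CARD('b)"
  define a where "a = 1 / (?N * ?N' * (?N * ?N' + 1))"
  let ?m = "\<lambda>i j k l (x :: complex^('a \<times> 'b)). (x $ (i, k) * cnj (x $ (j, k))) * (cnj (x $ (i, l)) * x $ (j, l))"
  have int: "integrable \<nu> (?m i j k l)" for i j k l
    by (intro integrable_continuous continuous_intros)
  have sq: "(\<integral>x. (x $ p * cnj (x $ p)) * (x $ q * cnj (x $ q)) \<partial>\<nu>)
      = complex_of_real ((if p = q then 2 else 1) * a)" for p q
  proof -
    have "(\<integral>x. (x $ p * cnj (x $ p)) * (x $ q * cnj (x $ q)) \<partial>\<nu>) = complex_of_real (\<integral>x. (norm (x $ p))\<^sup>2 * (norm (x $ q))\<^sup>2 \<partial>\<nu>)"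
      unfolding complex_norm_square[symmetric] of_real_mult[symmetric] integral_complex_of_real ..
    also have "(\<integral>x. (norm (x $ p))\<^sup>2 * (norm (x $ q))\<^sup>2 \<partial>\<nu>) = (if p = q then 2 else 1) * a"
      unfolding integral_coordinate_square_product a_def by simp
    finally show ?thesis .
  qed
  have moment: "(\<integral>x. ?m i j k l x \<partial>\<nu>) = complex_of_real ((if i = j then a else 0) + (if k = l then a else 0))" for i j k l
  proof -
    consider "i = j" | "i \<noteq> j" "k = l" | "i \<noteq> j" "k \<noteq> l" by blast
    then show ?thesis
    proof cases
      case 1
      then show ?thesis
        using sq[of "(i, k)" "(i, l)"] by (simp add: mult_ac)
    next
      case 2
      then show ?thesis
        using sq[of "(i, k)" "(j, k)"] by (simp add: mult_ac)
    next
      case 3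
      have "(\<integral>x. ?m i j k l x \<partial>\<nu>) = 0"
        using 3 by (intro integral_odd_coordinate[of _ "(i, k)"] continuous_intros) auto
      then show ?thesis
        using 3 by simp
    qed
  qed
  have "complex_of_real ((norm (reduced_pure_state x))\<^sup>2) = (\<Sum>i\<in>UNIV. \<Sum>j\<in>UNIV. \<Sum>k\<in>UNIV. \<Sum>l\<in>UNIV. ?m i j k l x)"
    for x :: "complex^('a \<times> 'b)"
  proof -
    have "(norm (reduced_pure_state x))\<^sup>2 = (\<Sum>i\<in>UNIV. \<Sum>j\<in>UNIV. (norm (reduced_pure_state x $ i $ j))\<^sup>2)"
      by (simp add: norm_vec_def L2_set_def sum_nonneg)
    then show ?thesis
      by (simp only: of_real_sum complex_norm_square reduced_pure_state_nth cnj_sum sum_product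
          complex_cnj_mult complex_cnj_cnj)
  qed
  then have "complex_of_real (\<integral>x. (norm (reduced_pure_state x))\<^sup>2 \<partial>\<nu>) = (\<integral>x. (\<Sum>i\<in>UNIV. \<Sum>j\<in>UNIV. \<Sum>k\<in>UNIV. \<Sum>l\<in>UNIV. ?m i j k l x) \<partial>\<nu>)"
    by (simp only: integral_complex_of_real[symmetric])
  also have "\<dots> = complex_of_real (\<Sum>i\<in>(UNIV::'a set). \<Sum>j\<in>(UNIV::'a set). \<Sum>k\<in>(UNIV::'b set). \<Sum>l\<in>(UNIV::'b set).
      (if i = j then a else 0) + (if k = l then a else 0))"
    using int by (simp only: Bochner_Integration.integral_sum Bochner_Integration.integrable_sum moment of_real_sum)
  also have "(\<Sum>i\<in>(UNIV::'a set). \<Sum>j\<in>(UNIV::'a set). \<Sum>k\<in>(UNIV::'b set). \<Sum>l\<in>(UNIV::'b set).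
      (if i = j then a else 0) + (if k = l then a else 0)) = ?N * ?N' * (?N + ?N') * a"
    by (simp add: sum.distrib sum_distrib_left[symmetric] algebra_simps)
  also have "\<dots> = (?N + ?N') / (?N * ?N' + 1)"
    by (simp add: a_def)
  finally show ?thesis
    by (simp only: of_real_eq_iff)
qed

lemma norm_diff_maximally_mixed:
  fixes \<rho> :: "complex^'a^'a"
  assumes "trace \<rho> = 1"
  shows "(norm (\<rho> - mat (1 / of_nat CARD('a))))\<^sup>2 = (norm \<rho>)\<^sup>2 - 1 / real CARD('a)"
proof -
  let ?c = "mat (1 / of_nat CARD('a)) :: complex^'a^'a"
  have inner: "\<sigma> \<bullet> ?c = Re (trace \<sigma>) / real CARD('a)" for \<sigma> :: "complex^'a^'a"
  proof -
    have "\<sigma> \<bullet> ?c = (\<Sum>i\<in>UNIV. \<Sum>j\<in>UNIV. if i = j then Re (\<sigma> $ i $ j) / real CARD('a) else 0)"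
      unfolding inner_vec_def mat_def vec_lambda_beta
      by (intro sum.cong) (auto simp: inner_complex_def)
    then show ?thesis
      by (simp add: trace_def sum_divide_distrib)
  qed
  have "trace ?c = 1"
    by (simp add: trace_def mat_def)
  then have "(norm (\<rho> - ?c))\<^sup>2 = (norm \<rho>)\<^sup>2 - 2 * (\<rho> \<bullet> ?c) + ?c \<bullet> ?c"
    by (simp add: power2_norm_eq_inner inner_diff_left inner_diff_right inner_commute)
  also have "\<dots> = (norm \<rho>)\<^sup>2 - 1 / real CARD('a)"
    unfolding inner \<open>trace ?c = 1\<close> assms by simp
  finally show ?thesis .
qed

lemma trace_reduced_pure_state_self: "trace (reduced_pure_state x) = complex_of_real ((norm x)\<^sup>2)"
  by (simp only: trace_partial_trace_B trace_rank_one_projector)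

lemma continuous_on_reduced_pure_state [continuous_intros]:
  "continuous_on S f \<Longrightarrow> continuous_on S (\<lambda>x. reduced_pure_state (f x))"
  unfolding partial_trace_B_def rank_one_projector_def by (intro continuous_intros)

lemma integrable_ergotropy:
  fixes \<nu> :: "(complex^('a::finite \<times> 'b::finite)) measure"
  assumes \<nu>: "unitary_invariant_sphere \<nu>" and H: "hermitian H"
  shows "integrable \<nu> (\<lambda>x. ergotropy H (reduced_pure_state x))"
proof -
  interpret unitary_invariant_sphere \<nu> by fact
  show ?thesis
  proof (rule integrable_const_bound)
    show "AE x in \<nu>. norm (ergotropy H (reduced_pure_state x)) \<le> 2 * spectral_norm H"
      using sphere
    proof eventually_elim
      fix x :: "complex^('a \<times> 'b)" assume "norm x = 1"
      then show "norm (ergotropy H (reduced_pure_state x)) \<le> 2 * spectral_norm H"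
        using ergotropy_le[OF H, of x] ergotropy_nonneg[of H "reduced_pure_state x"] by simp
    qed
    show "(\<lambda>x. ergotropy H (reduced_pure_state x)) \<in> borel_measurable \<nu>"
      unfolding measurable_cong_sets[OF sets_eq refl] by (rule borel_measurable_ergotropy[OF H])
  qed
qed

lemma integrable_exp_ergotropy:
  fixes \<nu> :: "(complex^('a::finite \<times> 'b::finite)) measure"
  assumes \<nu>: "unitary_invariant_sphere \<nu>" and H: "hermitian H"
  shows "integrable \<nu> (\<lambda>x. exp (a * ergotropy H (reduced_pure_state x)))"
proof -
  interpret unitary_invariant_sphere \<nu> by fact
  let ?f = "\<lambda>x :: complex^('a \<times> 'b). ergotropy H (reduced_pure_state x)"
  show ?thesis
  proof (rule integrable_const_bound)
    show "AE x in \<nu>. norm (exp (a * ?f x)) \<le> exp (\<bar>a\<bar> * (2 * spectral_norm H))"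
      using sphere
    proof eventually_elim
      fix x :: "complex^('a \<times> 'b)" assume "norm x = 1"
      then have "a * ?f x \<le> \<bar>a\<bar> * (2 * spectral_norm H)"
        using ergotropy_le[OF H, of x] ergotropy_nonneg[of H] by (intro mult_mono) auto
      then show "norm (exp (a * ?f x)) \<le> exp (\<bar>a\<bar> * (2 * spectral_norm H))"
        by simp
    qed
    show "(\<lambda>x. exp (a * ?f x)) \<in> borel_measurable \<nu>"
      unfolding measurable_cong_sets[OF sets_eq refl]
      using measurable_compose[OF borel_measurable_ergotropy[OF H], of "\<lambda>t. exp (a * t)" borel] by simp
  qed
qed

lemma integral_ergotropy_le:
  fixes \<nu> :: "(complex^('a::finite \<times> 'b::finite)) measure"
  assumes \<nu>: "unitary_invariant_sphere \<nu>" and H: "hermitian H"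
  shows "(\<integral>x. ergotropy H (reduced_pure_state x) \<partial>\<nu>) \<le> spectral_norm H * sqrt (real CARD('a) / real CARD('b))"
proof -
  interpret unitary_invariant_sphere \<nu> by fact
  let ?N = "real CARD('a)" and ?N' = "real CARD('b)" and ?h = "spectral_norm H"
  let ?T = "\<lambda>x :: complex^('a \<times> 'b). Re (trace (H ** reduced_pure_state x))"
  let ?n = "\<lambda>x :: complex^('a \<times> 'b). (norm (reduced_pure_state x))\<^sup>2"
  \<comment> \<open>The inequality D \<le> (D^2 / \<tau> + \<tau>) / 2 makes the second moment of
    the distance D enter linearly under the integral, with no square root of an expectation. Since
    the mean of D^2 is at most 1 / N', this \<tau> is the best weight for that bound.\<close>
  define \<tau> where "\<tau> = 1 / sqrt ?N'"
  have \<tau>: "0 < \<tau>" "\<tau>\<^sup>2 = 1 / ?N'"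
    by (simp_all add: \<tau>_def power_divide)
  let ?g = "\<lambda>x. ?T x - Re (trace H) / ?N + ?h * sqrt ?N * (((?n x - 1 / ?N) / \<tau> + \<tau>) / 2)"
  have le: "AE x in \<nu>. ergotropy H (reduced_pure_state x) \<le> ?g x"
    using sphere
  proof eventually_elim
    fix x :: "complex^('a \<times> 'b)" assume x: "norm x = 1"
    then have tr: "trace (reduced_pure_state x) = 1"
      by (simp add: trace_reduced_pure_state_self)
    define D where "D = norm (reduced_pure_state x - mat (1 / of_nat CARD('a)))"
    have "0 \<le> (D - \<tau>)\<^sup>2"
      by simp
    then have "D \<le> (D\<^sup>2 / \<tau> + \<tau>) / 2"
      using \<tau>(1) by (simp add: field_simps power2_eq_square)
    then have "D \<le> ((?n x - 1 / ?N) / \<tau> + \<tau>) / 2"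
      unfolding D_def norm_diff_maximally_mixed[OF tr] .
    then have "?h * sqrt ?N * D \<le> ?h * sqrt ?N * (((?n x - 1 / ?N) / \<tau> + \<tau>) / 2)"
      by (intro mult_left_mono) (simp_all add: spectral_norm_nonneg)
    then show "ergotropy H (reduced_pure_state x) \<le> ?g x"
      using ergotropy_le_deviation[OF H tr] unfolding D_def[symmetric] by linarith
  qed
  have intT: "integrable \<nu> ?T"
    by (intro integrable_continuous continuous_intros continuous_on_trace continuous_on_matrix_mult)
  have intn: "integrable \<nu> ?n"
    by (intro integrable_continuous continuous_intros)
  have "(\<integral>x. ergotropy H (reduced_pure_state x) \<partial>\<nu>) \<le> (\<integral>x. ?g x \<partial>\<nu>)"
    using intT intn by (intro integral_mono_AE integrable_ergotropy[OF \<nu> H] le) simp_all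
  also have "\<dots> = ?h * sqrt ?N * ((((?N + ?N') / (?N * ?N' + 1) - 1 / ?N) / \<tau> + \<tau>) / 2)"
    using intT intn integral_trace_reduced_pure_state[OF \<nu>, of H] integral_norm_reduced_pure_state[OF \<nu>]
    by (simp add: prob_space)
  also have "\<dots> \<le> ?h * sqrt ?N * \<tau>"
  proof -
    have "(?N + ?N') / (?N * ?N' + 1) \<le> (?N + ?N') / (?N * ?N')"
      by (intro divide_left_mono mult_pos_pos add_pos_pos) simp_all
    also have "\<dots> = 1 / ?N' + 1 / ?N"
      by (simp add: field_simps)
    finally have "(?N + ?N') / (?N * ?N' + 1) - 1 / ?N \<le> \<tau>\<^sup>2"
      by (simp add: \<tau>(2))
    then have "((?N + ?N') / (?N * ?N' + 1) - 1 / ?N) / \<tau> \<le> \<tau>"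
      using \<tau>(1) by (simp add: field_simps power2_eq_square)
    then show ?thesis
      by (intro mult_left_mono) (simp_all add: spectral_norm_nonneg)
  qed
  also have "\<dots> = ?h * sqrt (?N / ?N')"
    by (simp add: \<tau>_def real_sqrt_divide)
  finally show ?thesis .
qed

section \<open>Polar decomposition of the Gaussian by Haar averaging\<close>

lemma haar_unitary_average_invariant:
  fixes M :: "(complex^'d^'d) measure" and \<mu> :: "(complex^'d) measure"
  assumes M: "haar_unitary M" and "sigma_finite_measure \<mu>" and sets: "sets \<mu> = sets borel"
    and inv: "\<And>V. V \<in> unitary_group \<Longrightarrow> distr \<mu> borel ((*v) V) = \<mu>"
    and F: "F \<in> borel_measurable borel"
  shows "(\<integral>\<^sup>+x. F x \<partial>\<mu>) = (\<integral>\<^sup>+x. (\<integral>\<^sup>+U. F (adjoint_matrix U *v x) \<partial>M) \<partial>\<mu>)"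
proof -
  interpret M: prob_space M
    using M by (simp add: haar_unitary_def)
  interpret \<mu>: sigma_finite_measure \<mu> by fact
  interpret P: pair_sigma_finite M \<mu> ..
  note mid = haar_unitary_measurable_id[OF M]
  have "(\<integral>\<^sup>+x. F x \<partial>\<mu>) = (\<integral>\<^sup>+U. (\<integral>\<^sup>+x. F x \<partial>\<mu>) \<partial>M)"
    by (simp add: M.emeasure_space_1)
  also have "\<dots> = (\<integral>\<^sup>+U. (\<integral>\<^sup>+x. F (adjoint_matrix U *v x) \<partial>\<mu>) \<partial>M)"
  proof (rule nn_integral_cong)
    fix U assume "U \<in> space M"
    then have U: "adjoint_matrix U \<in> unitary_group"
      using haar_unitary_space[OF M] by (simp add: unitary_group_adjoint)
    have "(*v) (adjoint_matrix U) \<in> measurable \<mu> borel"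
      unfolding measurable_cong_sets[OF sets refl]
      by (intro borel_measurable_continuous_onI continuous_on_matrix_vector_mult continuous_intros)
    then show "(\<integral>\<^sup>+x. F x \<partial>\<mu>) = (\<integral>\<^sup>+x. F (adjoint_matrix U *v x) \<partial>\<mu>)"
      using F by (subst inv[OF U, symmetric], subst nn_integral_distr) auto
  qed
  also have "\<dots> = (\<integral>\<^sup>+x. (\<integral>\<^sup>+U. F (adjoint_matrix U *v x) \<partial>M) \<partial>\<mu>)"
  proof (rule P.Fubini'[symmetric])
    have "(\<lambda>p. adjoint_matrix (fst p) *v snd p) \<in> borel_measurable (borel :: ((complex^'d^'d) \<times> (complex^'d)) measure)"
      by (intro borel_measurable_continuous_onI continuous_on_matrix_vector_mult continuous_on_adjoint_matrix continuous_intros)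
    moreover have "(\<lambda>p. p) \<in> measurable (M \<Otimes>\<^sub>M \<mu>) (borel :: ((complex^'d^'d) \<times> (complex^'d)) measure)"
    proof -
      have "snd \<in> measurable (M \<Otimes>\<^sub>M \<mu>) (borel :: (complex^'d) measure)"
        using measurable_snd[of M \<mu>] unfolding measurable_cong_sets[OF refl sets] .
      from measurable_Pair[OF measurable_compose[OF measurable_fst mid] this]
      show ?thesis
        by (simp add: borel_prod)
    qed
    ultimately have "(\<lambda>p. adjoint_matrix (fst p) *v snd p) \<in> measurable (M \<Otimes>\<^sub>M \<mu>) borel"
      using measurable_compose by blast
    from measurable_compose[OF this F]
    show "(\<lambda>(U, x). F (adjoint_matrix U *v x)) \<in> borel_measurable (M \<Otimes>\<^sub>M \<mu>)"
      by (simp add: case_prod_beta)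
  qed
  finally show ?thesis .
qed

text \<open>\<open>haar_unitary\<close> states left invariance, whereas invariance in x is wanted.
  The adjoint converts one into the other: replacing U by V^* U changes U^* x into U^* V x, and
  transitivity supplies a V with V x = y.\<close>

lemma haar_unitary_nn_integral_right:
  fixes M :: "(complex^'d^'d) measure" and x y :: "complex^'d"
  assumes M: "haar_unitary M" and "norm x = norm y" and F: "F \<in> borel_measurable borel"
  shows "(\<integral>\<^sup>+U. F (adjoint_matrix U *v x) \<partial>M) = (\<integral>\<^sup>+U. F (adjoint_matrix U *v y) \<partial>M)"
proof -
  obtain V where V: "V \<in> unitary_group" "V *v x = y"
    using unitary_group_transitive[OF \<open>norm x = norm y\<close>] .
  have "(\<lambda>U. adjoint_matrix U *v x) \<in> borel_measurable borel"
    by (intro borel_measurable_continuous_onI continuous_on_matrix_vector_mult continuous_on_adjoint_matrix continuous_intros)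
  from haar_unitary_nn_integral_left[OF M unitary_group_adjoint[OF V(1)] measurable_compose[OF this F]]
  show ?thesis
    by (simp add: adjoint_matrix_mult V(2) flip: matrix_vector_mul_assoc)
qed

lemma std_gaussian_unitary_invariant:
  "V \<in> unitary_group \<Longrightarrow> distr std_gaussian borel ((*v) V) = (std_gaussian :: (complex^'d) measure)"
  by (rule distr_std_gaussian_isometry) (simp_all add: norm_unitary_mult)

text \<open>Averaging over the same Haar measure is applied to the Gaussian and to the law on the
  sphere. The averaged function h depends only on the norm, so its value at x is its value at norm x
  times \<psi>, which is the spherical integral at radius norm x. This yields polar coordinates
  without a surface measure.\<close>

lemma nn_integral_std_gaussian_polar:
  fixes M :: "(complex^'d^'d) measure" and \<psi> :: "complex^'d"
  assumes M: "haar_unitary M" and \<psi>: "norm \<psi> = 1" and F: "F \<in> borel_measurable borel"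
  defines "\<nu> \<equiv> distr M borel (\<lambda>U. U *v \<psi>)"
  shows "(\<integral>\<^sup>+x. F x \<partial>std_gaussian) = (\<integral>\<^sup>+x. (\<integral>\<^sup>+y. F (norm x *\<^sub>R y) \<partial>\<nu>) \<partial>(std_gaussian :: (complex^'d) measure))"
proof -
  interpret \<nu>: unitary_invariant_sphere \<nu>
    unfolding \<nu>_def by (rule haar_unitary_orbit[OF M \<psi>])
  interpret G: prob_space "std_gaussian :: (complex^'d) measure" by (rule prob_space_std_gaussian)
  define h where "h x = (\<integral>\<^sup>+U. F (adjoint_matrix U *v x) \<partial>M)" for x
  have h: "norm x = norm y \<Longrightarrow> h x = h y" for x y
    unfolding h_def by (rule haar_unitary_nn_integral_right[OF M _ F])
  have orbit: "(\<integral>\<^sup>+y. F (r *\<^sub>R y) \<partial>\<nu>) = h (r *\<^sub>R \<psi>)" for r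
  proof -
    have "(\<lambda>y. r *\<^sub>R y) \<in> borel_measurable (borel :: (complex^'d) measure)"
      by simp
    then have "(\<integral>\<^sup>+y. F (r *\<^sub>R y) \<partial>\<nu>) = (\<integral>\<^sup>+x. (\<integral>\<^sup>+U. F (r *\<^sub>R (adjoint_matrix U *v x)) \<partial>M) \<partial>\<nu>)"
      using F by (intro haar_unitary_average_invariant[OF M \<nu>.sigma_finite_measure_axioms \<nu>.sets_eq \<nu>.invariant]
          measurable_compose[OF _ F])
    also have "\<dots> = (\<integral>\<^sup>+x. h (r *\<^sub>R x) \<partial>\<nu>)"
      by (simp add: h_def linear_scale[OF bounded_linear.linear[OF matrix_vector_mul_bounded_linear]])
    also have "\<dots> = (\<integral>\<^sup>+x. h (r *\<^sub>R \<psi>) \<partial>\<nu>)"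
      using \<nu>.sphere by (intro nn_integral_cong_AE) (auto elim!: eventually_mono intro!: h simp: \<psi>)
    finally show ?thesis
      by (simp add: \<nu>.emeasure_space_1)
  qed
  have "(\<integral>\<^sup>+x. F x \<partial>std_gaussian) = (\<integral>\<^sup>+x. h x \<partial>std_gaussian)"
    unfolding h_def by (intro haar_unitary_average_invariant[OF M G.sigma_finite_measure_axioms _ _ F])
      (simp_all add: std_gaussian_unitary_invariant)
  also have "\<dots> = (\<integral>\<^sup>+x. (\<integral>\<^sup>+y. F (norm x *\<^sub>R y) \<partial>\<nu>) \<partial>(std_gaussian :: (complex^'d) measure))"
    unfolding orbit by (intro nn_integral_cong h) (simp add: \<psi>)
  finally show ?thesis .
qed

text \<open>The right-hand side is the mean of exp (b R^2) for the norm R of an m-dimensional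
  Gaussian vector, and the mean of R^2 is m; so this is Jensen's inequality for the radius in
  explicit form. It is applied with b of either sign.\<close>

lemma exp_le_gaussian_mgf_factor:
  fixes b :: real
  assumes "b < 1/2"
  shows "exp (real m * b) \<le> (1 / sqrt (1 - 2 * b)) ^ m"
proof -
  have "1 - 2 * b \<le> exp (- 2 * b)"
    using exp_ge_add_one_self[of "- 2 * b"] by simp
  then have "sqrt (1 - 2 * b) \<le> sqrt (exp (- 2 * b))"
    by (rule real_sqrt_le_mono)
  also have "sqrt (exp (- 2 * b)) = exp (- b)"
    by (rule real_sqrt_unique) (simp_all flip: exp_double)
  finally have "exp b \<le> 1 / sqrt (1 - 2 * b)"
    using assms by (simp add: exp_minus field_simps)
  then have "exp b ^ m \<le> (1 / sqrt (1 - 2 * b)) ^ m"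
    by (intro power_mono) auto
  then show ?thesis
    by (simp add: exp_of_nat_mult)
qed

text \<open>For each direction y, homogeneity makes the Gaussian exponent s * f y times the squared
  radius, and its integral over the radius is explicit and finite for s * f y < 1/2. Jensen's
  inequality replaces the squared radius by its mean, the real dimension.\<close>

lemma sphere_mgf_le_gaussian_mgf:
  fixes M :: "(complex^'d^'d) measure" and \<psi> :: "complex^'d"
  assumes M: "haar_unitary M" and \<psi>: "norm \<psi> = 1"
    and f [measurable]: "f \<in> borel_measurable borel"
    and hom: "\<And>r x. f (r *\<^sub>R x) = r\<^sup>2 * f x"
    and small: "\<And>x. norm x = 1 \<Longrightarrow> s * f x < 1/2"
  defines "\<nu> \<equiv> distr M borel (\<lambda>U. U *v \<psi>)"
  shows "(\<integral>\<^sup>+x. ennreal (exp (real DIM(complex^'d) * s * f x)) \<partial>\<nu>) \<le> (\<integral>\<^sup>+x. ennreal (exp (s * f x)) \<partial>(std_gaussian :: (complex^'d) measure))"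
proof -
  interpret \<nu>: unitary_invariant_sphere \<nu>
    unfolding \<nu>_def by (rule haar_unitary_orbit[OF M \<psi>])
  interpret G: prob_space "std_gaussian :: (complex^'d) measure" by (rule prob_space_std_gaussian)
  interpret P: pair_sigma_finite "std_gaussian :: (complex^'d) measure" \<nu> ..
  note [measurable_cong] = \<nu>.sets_eq
  have "(\<integral>\<^sup>+x. ennreal (exp (s * f x)) \<partial>(std_gaussian :: (complex^'d) measure)) = (\<integral>\<^sup>+x. (\<integral>\<^sup>+y. ennreal (exp (s * f (norm x *\<^sub>R y))) \<partial>\<nu>) \<partial>(std_gaussian :: (complex^'d) measure))"
    unfolding \<nu>_def by (rule nn_integral_std_gaussian_polar[OF M \<psi>]) simp
  also have "\<dots> = (\<integral>\<^sup>+y. (\<integral>\<^sup>+x. ennreal (exp (s * f (norm x *\<^sub>R y))) \<partial>(std_gaussian :: (complex^'d) measure)) \<partial>\<nu>)"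
    unfolding hom by (rule P.Fubini'[symmetric]) measurable
  finally have *: "(\<integral>\<^sup>+x. ennreal (exp (s * f x)) \<partial>(std_gaussian :: (complex^'d) measure)) = (\<integral>\<^sup>+y. (\<integral>\<^sup>+x. ennreal (exp (s * f (norm x *\<^sub>R y))) \<partial>(std_gaussian :: (complex^'d) measure)) \<partial>\<nu>)" .
  show ?thesis
    unfolding *
  proof (rule nn_integral_mono_AE)
    show "AE y in \<nu>. ennreal (exp (real DIM(complex^'d) * s * f y)) \<le> (\<integral>\<^sup>+x. ennreal (exp (s * f (norm x *\<^sub>R y))) \<partial>(std_gaussian :: (complex^'d) measure))"
      using \<nu>.sphere
    proof eventually_elim
      fix y :: "complex^'d" assume "norm y = 1"
      then have b: "s * f y < 1/2"
        by (rule small)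
      have "(\<integral>\<^sup>+x. ennreal (exp (s * f (norm x *\<^sub>R y))) \<partial>(std_gaussian :: (complex^'d) measure))
          = ennreal ((1 / sqrt (1 - 2 * (s * f y))) ^ DIM(complex^'d))"
        using nn_integral_std_gaussian_exp[OF b, of "0 :: complex^'d"] by (simp add: hom mult_ac)
      then show "ennreal (exp (real DIM(complex^'d) * s * f y)) \<le> (\<integral>\<^sup>+x. ennreal (exp (s * f (norm x *\<^sub>R y))) \<partial>(std_gaussian :: (complex^'d) measure))"
        using exp_le_gaussian_mgf_factor[OF b, of "DIM(complex^'d)"] by (simp add: ennreal_leI mult.assoc)
    qed
  qed
qed

section \<open>Exponential moments and the tail of the ergotropy\<close>

lemma (in prob_space) exp_expectation_le:
  fixes f :: "'a \<Rightarrow> real"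
  assumes f: "integrable M f" and ef: "integrable M (\<lambda>x. exp (a * f x))"
  shows "exp (a * expectation f) \<le> expectation (\<lambda>x. exp (a * f x))"
proof -
  let ?m = "expectation f"
  \<comment> \<open>The integrand is the tangent line of exp at the mean, which has expectation exp
    (a * ?m) and lies below exp.\<close>
  have "exp (a * ?m) = expectation (\<lambda>x. exp (a * ?m) * (1 + a * (f x - ?m)))"
    using f by (simp add: prob_space)
  also have "\<dots> \<le> expectation (\<lambda>x. exp (a * f x))"
  proof (rule Bochner_Integration.integral_mono)
    fix x
    have "exp (a * ?m) * (1 + a * (f x - ?m)) \<le> exp (a * ?m) * exp (a * (f x - ?m))"
      by (intro mult_left_mono exp_ge_add_one_self) simp
    then show "exp (a * ?m) * (1 + a * (f x - ?m)) \<le> exp (a * f x)"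
      by (simp add: algebra_simps flip: exp_add)
  qed (use f ef in simp_all)
  finally show ?thesis .
qed

text \<open>The constant 160 is 20 * 2 * 4: the Gaussian rate 20 per real dimension, 2 d real
  dimensions, and c^2 = 4 \<open>(spectral_norm H)\<^sup>2\<close>. The restriction on s gives (s
  c)^2 \<le> 1/64, within the 1/40 required for concentration, and s * f \<le> 1/8 on the sphere,
  below the 1/2 required for integrating out the radius.\<close>

lemma ergotropy_mgf_le:
  fixes H :: "complex^'a^'a" and \<psi> :: "complex^('a::finite \<times> 'b::finite)"
    and M :: "(complex^('a \<times> 'b)^('a \<times> 'b)) measure"
  assumes M: "haar_unitary M" and \<psi>: "norm \<psi> = 1" and H: "hermitian H"
    and h: "0 < spectral_norm H" and s: "0 < s" "s * spectral_norm H \<le> 1/16"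
  defines "\<nu> \<equiv> distr M borel (\<lambda>U. U *v \<psi>)"
    and "d \<equiv> real CARD('a) * real CARD('b)" and "f \<equiv> \<lambda>x. ergotropy H (reduced_pure_state x)"
  shows "(\<integral>x. exp (2 * d * s * f x) \<partial>\<nu>)
    \<le> exp (160 * d * (s * spectral_norm H)\<^sup>2 + 2 * d * s * (\<integral>x. f x \<partial>\<nu>))"
proof -
  interpret unitary_invariant_sphere \<nu>
    unfolding \<nu>_def by (rule haar_unitary_orbit[OF M \<psi>])
  have \<nu>: "unitary_invariant_sphere \<nu>"
    unfolding \<nu>_def by (rule haar_unitary_orbit[OF M \<psi>])
  let ?h = "spectral_norm H"
  have meas: "f \<in> borel_measurable borel"
    unfolding f_def by (rule borel_measurable_ergotropy[OF H])
  have hom: "f (r *\<^sub>R x) = r\<^sup>2 * f x" for r x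
    unfolding f_def by (rule ergotropy_scaleR[OF H])
  have f_bounds: "0 \<le> f x" "norm x = 1 \<Longrightarrow> f x \<le> 2 * ?h" for x
    using ergotropy_nonneg[of H] ergotropy_le[OF H, of x] by (simp_all add: f_def)
  have small: "s * f x < 1/2" "- s * f x < 1/2" if "norm x = 1" for x
  proof -
    have "s * f x \<le> s * (2 * ?h)"
      using s f_bounds that by (intro mult_left_mono) auto
    also have "\<dots> = 2 * (s * ?h)"
      by simp
    finally show "s * f x < 1/2"
      using s by linarith
    have "0 \<le> s * f x"
      using s f_bounds(1)[of x] by (intro mult_nonneg_nonneg) auto
    then show "- s * f x < 1/2"
      by (simp only: mult_minus_left)
  qed
  have D: "real DIM(complex^('a \<times> 'b)) = 2 * d"
    by (simp add: d_def)
  have meas\<nu>: "f \<in> borel_measurable \<nu>"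
    using meas unfolding measurable_cong_sets[OF sets_eq refl] .
  have intf: "integrable \<nu> f"
    unfolding f_def by (rule integrable_ergotropy[OF \<nu> H])
  have int_exp: "integrable \<nu> (\<lambda>x. exp (a * f x))" for a
    unfolding f_def by (rule integrable_exp_ergotropy[OF \<nu> H])
  have nn: "(\<integral>\<^sup>+x. ennreal (exp (a * f x)) \<partial>\<nu>) = ennreal (\<integral>x. exp (a * f x) \<partial>\<nu>)" for a
    by (intro nn_integral_eq_integral int_exp) simp
  have "(s * (2 * ?h))\<^sup>2 \<le> (1/8)\<^sup>2"
    using s h by (intro power_mono) auto
  then have sc: "(s * (2 * ?h))\<^sup>2 \<le> 1/40"
    by (simp add: power2_eq_square)
  have "ennreal ((\<integral>x. exp (2 * d * s * f x) \<partial>\<nu>) * (\<integral>x. exp (- (2 * d * s) * f x) \<partial>\<nu>))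
      = (\<integral>\<^sup>+x. ennreal (exp (2 * d * s * f x)) \<partial>\<nu>) * (\<integral>\<^sup>+x. ennreal (exp (- (2 * d * s) * f x)) \<partial>\<nu>)"
    unfolding nn by (simp add: ennreal_mult)
  also have "\<dots> \<le> (\<integral>\<^sup>+x. ennreal (exp (s * f x)) \<partial>std_gaussian) * (\<integral>\<^sup>+x. ennreal (exp (- s * f x)) \<partial>std_gaussian)"
    using sphere_mgf_le_gaussian_mgf[OF M \<psi> meas hom small(1)] sphere_mgf_le_gaussian_mgf[OF M \<psi> meas hom small(2)]
    unfolding D \<nu>_def[symmetric] by (intro mult_mono) simp_all
  also have "\<dots> \<le> ennreal (exp (20 * (2 * d) * (s * (2 * ?h))\<^sup>2))"
    unfolding D[symmetric] f_def
    using h s sc ergotropy_quadratic_max[OF H] meas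
    by (intro gaussian_quadratic_max_concentration) (auto simp: f_def)
  finally have "(\<integral>x. exp (2 * d * s * f x) \<partial>\<nu>) * (\<integral>x. exp (- (2 * d * s) * f x) \<partial>\<nu>)
      \<le> exp (20 * (2 * d) * (s * (2 * ?h))\<^sup>2)"
    by (simp only: ennreal_le_iff exp_ge_zero)
  \<comment> \<open>Jensen's inequality bounds the factor with the negative exponent from below;
    dividing by that bound leaves the positive exponential moment relative to its mean.\<close>
  moreover have "exp (- (2 * d * s) * (\<integral>x. f x \<partial>\<nu>)) \<le> (\<integral>x. exp (- (2 * d * s) * f x) \<partial>\<nu>)"
    by (rule exp_expectation_le[OF intf int_exp])
  then have "(\<integral>x. exp (2 * d * s * f x) \<partial>\<nu>) * exp (- (2 * d * s) * (\<integral>x. f x \<partial>\<nu>))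
      \<le> (\<integral>x. exp (2 * d * s * f x) \<partial>\<nu>) * (\<integral>x. exp (- (2 * d * s) * f x) \<partial>\<nu>)"
    by (intro mult_left_mono) simp_all
  ultimately have "(\<integral>x. exp (2 * d * s * f x) \<partial>\<nu>) * exp (- (2 * d * s * (\<integral>x. f x \<partial>\<nu>)))
      \<le> exp (160 * d * (s * ?h)\<^sup>2)"
    by (simp add: power_mult_distrib mult_ac)
  then show ?thesis
    by (simp add: exp_add exp_minus field_simps)
qed

theorem theorem1:
  fixes H :: "complex^'a^'a"
    and \<psi>\<^sub>0 :: "complex^('a::finite \<times> 'b::finite)"
    and M :: "(complex^('a \<times> 'b)^('a \<times> 'b)) measure"
    and n :: nat and \<gamma> :: real
  assumes "CARD('a) = 2 ^ n"
    and "CARD('b) > CARD('a)"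
    and "hermitian H"
    and "norm \<psi>\<^sub>0 = 1"
    and "haar_unitary M"
    and "\<gamma> > 2 * spectral_norm H * sqrt (real CARD('a) / real CARD('b))"
  shows "measure M {U \<in> space M. ergotropy H (reduced_state \<psi>\<^sub>0 U) > \<gamma>}
    \<le> exp (- (real CARD('a) * real CARD('b) * \<gamma>\<^sup>2 / (768 * (spectral_norm H)\<^sup>2)))"
proof -
  interpret M: prob_space M
    using assms(5) by (simp add: haar_unitary_def)
  let ?h = "spectral_norm H"
  define d where "d = real CARD('a) * real CARD('b)"
  define f where "f x = ergotropy H (reduced_pure_state x)" for x :: "complex^('a \<times> 'b)"
  have f: "ergotropy H (reduced_state \<psi>\<^sub>0 U) = f (U *v \<psi>\<^sub>0)" for U
    by (simp add: reduced_state_def unitary_conj_rank_one_projector f_def)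
  have "0 \<le> ?h"
    by (rule spectral_norm_nonneg)
  then have \<gamma>0: "0 < \<gamma>"
    using assms(6) by (smt (verit) mult_nonneg_nonneg real_sqrt_ge_zero divide_nonneg_nonneg of_nat_0_le_iff)
  consider "?h = 0" | "0 < ?h" "2 * ?h < \<gamma>" | "0 < ?h" "\<gamma> \<le> 2 * ?h"
    using \<open>0 \<le> ?h\<close> by linarith
  then show ?thesis
  proof cases
    case 1
    \<comment> \<open>Division by 0 yields 0, so the right-hand side is exp 0 = 1.\<close>
    then show ?thesis by simp
  next
    case 2
    \<comment> \<open>On unit vectors the ergotropy never exceeds
      \<open>2 * spectral_norm H\<close>, so the event is empty. What remains is \<gamma> \<le>
      \<open>2 * spectral_norm H\<close>, the range in which the s chosen below is
      admissible.\<close>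
    have "f (U *v \<psi>\<^sub>0) \<le> 2 * ?h" if "U \<in> space M" for U
      using ergotropy_le[OF assms(3), of "U *v \<psi>\<^sub>0"] that haar_unitary_space[OF assms(5)] assms(4)
      by (simp add: norm_unitary_mult f_def)
    then have "{U \<in> space M. \<gamma> < ergotropy H (reduced_state \<psi>\<^sub>0 U)} = {}"
      using 2 unfolding f by force
    then show ?thesis
      by (simp only: measure_empty exp_ge_zero)
  next
    case 3
    define \<nu> where "\<nu> = distr M borel (\<lambda>U. U *v \<psi>\<^sub>0)"
    have \<nu>: "unitary_invariant_sphere \<nu>"
      unfolding \<nu>_def by (rule haar_unitary_orbit[OF assms(5,4)])
    interpret unitary_invariant_sphere \<nu> by (rule \<nu>)
    \<comment> \<open>With h for \<open>spectral_norm H\<close>, this minimizes 160 d (s h)^2 - d s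
      \<gamma>, and the minimum is - d \<gamma>^2 / (640 h^2). For \<gamma> \<le> 2 h it gives s h
      \<le> 1/160.\<close>
    define s where "s = \<gamma> / (320 * ?h\<^sup>2)"
    have s: "0 < s" "s * ?h \<le> 1/16"
      using 3 \<gamma>0 by (simp_all add: s_def field_simps power2_eq_square)
    have d: "0 < d"
      by (simp add: d_def)
    have meas: "f \<in> borel_measurable borel"
      unfolding f_def by (rule borel_measurable_ergotropy[OF assms(3)])
    have meas\<nu>: "f \<in> borel_measurable \<nu>"
      using meas unfolding measurable_cong_sets[OF sets_eq refl] .
    have orbit: "(\<lambda>U. U *v \<psi>\<^sub>0) \<in> measurable M borel"
      by (intro measurable_compose[OF haar_unitary_measurable_id[OF assms(5)]] borel_measurable_continuous_onI
          continuous_on_matrix_vector_mult continuous_intros)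
    \<comment> \<open>Here the factor 2 in the lower bound on \<gamma> is spent: half of \<gamma>
      covers the mean and the other half remains as deviation.\<close>
    have mean: "(\<integral>x. f x \<partial>\<nu>) \<le> \<gamma> / 2"
      using integral_ergotropy_le[OF \<nu> assms(3)] assms(6) unfolding f_def by linarith
    have "{U \<in> space M. \<gamma> < ergotropy H (reduced_state \<psi>\<^sub>0 U)} = (\<lambda>U. U *v \<psi>\<^sub>0) -` {x. \<gamma> < f x} \<inter> space M"
      unfolding f by auto
    then have "measure M {U \<in> space M. ergotropy H (reduced_state \<psi>\<^sub>0 U) > \<gamma>} = measure \<nu> {x. \<gamma> < f x}"
      unfolding \<nu>_def using orbit meas by (subst measure_distr) auto
    also have "\<dots> \<le> measure \<nu> {x \<in> space \<nu>. exp (2 * d * s * \<gamma>) \<le> exp (2 * d * s * f x)}"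
      using s d meas\<nu> by (intro finite_measure_mono) (auto simp: \<nu>_def)
    also have "\<dots> \<le> (\<integral>x. exp (2 * d * s * f x) \<partial>\<nu>) / exp (2 * d * s * \<gamma>)"
    proof (rule integral_Markov_inequality_measure[where A="space \<nu>"])
      show "integrable \<nu> (\<lambda>x. exp (2 * d * s * f x))"
        unfolding f_def by (rule integrable_exp_ergotropy[OF \<nu> assms(3)])
    qed simp_all
    also have "\<dots> \<le> exp (160 * d * (s * ?h)\<^sup>2 + 2 * d * s * (\<integral>x. f x \<partial>\<nu>)) / exp (2 * d * s * \<gamma>)"
      using ergotropy_mgf_le[OF assms(5,4,3) 3(1) s]
      unfolding \<nu>_def[symmetric] d_def[symmetric] f_def by (intro divide_right_mono) simp_all
    also have "\<dots> = exp (160 * d * (s * ?h)\<^sup>2 + 2 * d * s * ((\<integral>x. f x \<partial>\<nu>) - \<gamma>))"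
      by (simp add: exp_diff[symmetric] algebra_simps)
    also have "\<dots> \<le> exp (160 * d * (s * ?h)\<^sup>2 - d * s * \<gamma>)"
    proof -
      have "2 * d * s * ((\<integral>x. f x \<partial>\<nu>) - \<gamma>) \<le> 2 * d * s * (- \<gamma> / 2)"
        using mean d s by (intro mult_left_mono) auto
      then show ?thesis by simp
    qed
    also have "160 * d * (s * ?h)\<^sup>2 - d * s * \<gamma> = - (d * \<gamma>\<^sup>2 / (640 * ?h\<^sup>2))"
      using 3 by (simp add: s_def field_simps power2_eq_square)
    also have "exp (- (d * \<gamma>\<^sup>2 / (640 * ?h\<^sup>2))) \<le> exp (- (d * \<gamma>\<^sup>2 / (768 * ?h\<^sup>2)))"
      using 3 d by (simp add: frac_le)
    finally show ?thesis
      unfolding d_def .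
  qed
qed

end
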